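(* Let $p=2$ and let $G$ be a profinite group of Galois relation type (relative to $2$). Then $G^{(3)}$ is the intersection of all normal open subgroups $N$ of $G$ such that $G/N$ is isomorphic to one of the groups $1$, $\mathbb{Z}/2$, $\mathbb{Z}/4$, $D_4$.
   Context: $G^{(1)}=G$ and $G^{(i+1)}=(G^{(i)})^2[G^{(i)},G]$ is the closed subgroup of $G$ generated by all $h^2$ and $[h,g]=h^{-1}g^{-1}hg$, $h\in G^{(i)}$, $g\in G$. $H^i(G)=H^i(G,\mathbb{Z}/2)$ is continuous cohomology with trivial action. The Bockstein map $\beta_G\colon H^1(G)\to H^2(G)$ is the connecting homomorphism of $0\to\mathbb{Z}/2\to\mathbb{Z}/4\to\mathbb{Z}/2\to0$. $G$ has Galois relation type (relative to $2$) if: (i) the kernel of the cup product homomorphism $H^1(G)\otimes_{\mathbb{Z}}H^1(G)\to H^2(G)$ is generated by elements of the form $\psi\otimes\psi'$ with $\psi,\psi'\in H^1(G)$; and (ii) there exists $\xi\in H^1(G)$ such that $\psi\cup\xi+\beta_G(\psi)=0$ for every $\psi\in H^1(G)$. (The paper's third condition, for $q=p^d$, that $H^1(G,\mathbb{Z}/q)\to H^1(G,\mathbb{Z}/p^i)$ is surjective for $1\le i\le d$, is vacuous for $q=p=2$.) $D_4=\langle r,s\mid r^4=s^2=(rs)^2=1\rangle$ is the dihedral group of order $8$. *)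

theory Defs
  imports "HOL-Analysis.Analysis" "HOL-Algebra.Algebra"
begin

section \<open>Profinite groups\<close>

locale profinite_group = group G for G :: "('a, 'b) monoid_scheme" (structure) and T :: "'a topology" +
  assumes topspace_eq: "topspace T = carrier G"
    and continuous_mult: "continuous_map (prod_topology T T) T (\<lambda>(x, y). x \<otimes> y)"
    and continuous_inv: "continuous_map T T (\<lambda>x. inv x)"
    and compact: "compact_space T"
    and Hausdorff: "Hausdorff_space T"
    and totally_disconnected: "\<And>x. x \<in> carrier G \<Longrightarrow> connected_component_of_set T x = {x}"

definition closed_subgroup_generated ::
  "('a, 'b) monoid_scheme \<Rightarrow> 'a topology \<Rightarrow> 'a set \<Rightarrow> 'a set" where
  "closed_subgroup_generated G T S = \<Inter> {H. subgroup H G \<and> closedin T H \<and> S \<subseteq> H}"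

text \<open>The descending 2-central sequence is indexed from 1; the value at 0 is a dummy.\<close>

definition descending_central ::
  "('a, 'b) monoid_scheme \<Rightarrow> 'a topology \<Rightarrow> nat \<Rightarrow> 'a set" where
  "descending_central G T i =
     ((\<lambda>H. closed_subgroup_generated G T
        ({h \<otimes>\<^bsub>G\<^esub> h | h. h \<in> H} \<union>
         {inv\<^bsub>G\<^esub> h \<otimes>\<^bsub>G\<^esub> inv\<^bsub>G\<^esub> g \<otimes>\<^bsub>G\<^esub> h \<otimes>\<^bsub>G\<^esub> g | h g. h \<in> H \<and> g \<in> carrier G}))
      ^^ (i - 1)) (carrier G)"


section \<open>Continuous cohomology in low degrees, trivial action\<close>

text \<open>
  Continuous inhomogeneous cochains with values in a discrete abelian group \<open>A\<close> on which \<open>G\<close>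
  acts trivially; \<open>A\<close> is written multiplicatively, as usual in HOL-Algebra. The cochains in
  degree 1, 2, 3 are the continuous functions on \<open>G\<close>, \<open>G \<times> G\<close>, \<open>G \<times> G \<times> G\<close>, made
  extensional so that equality of cochains is equality of functions.
\<close>

definition continuous_functions :: "'x topology \<Rightarrow> 'c monoid \<Rightarrow> ('x \<Rightarrow> 'c) monoid" where
  "continuous_functions Y A =
     \<lparr>carrier = {f \<in> extensional (topspace Y).
                  continuous_map Y (discrete_topology (carrier A)) f},
      monoid.mult = (\<lambda>f f'. \<lambda>x\<in>topspace Y. f x \<otimes>\<^bsub>A\<^esub> f' x),
      one = (\<lambda>x\<in>topspace Y. \<one>\<^bsub>A\<^esub>)\<rparr>"

abbreviation cochains1 :: "'a topology \<Rightarrow> 'c monoid \<Rightarrow> ('a \<Rightarrow> 'c) monoid" where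
  "cochains1 T A \<equiv> continuous_functions T A"

abbreviation cochains2 :: "'a topology \<Rightarrow> 'c monoid \<Rightarrow> ('a \<times> 'a \<Rightarrow> 'c) monoid" where
  "cochains2 T A \<equiv> continuous_functions (prod_topology T T) A"

abbreviation cochains3 :: "'a topology \<Rightarrow> 'c monoid \<Rightarrow> ('a \<times> 'a \<times> 'a \<Rightarrow> 'c) monoid" where
  "cochains3 T A \<equiv> continuous_functions (prod_topology T (prod_topology T T)) A"

definition coboundary1 ::
  "('a, 'b) monoid_scheme \<Rightarrow> 'c monoid \<Rightarrow> ('a \<Rightarrow> 'c) \<Rightarrow> ('a \<times> 'a \<Rightarrow> 'c)" where
  "coboundary1 G A f =
     restrict (\<lambda>(g, h). f h \<otimes>\<^bsub>A\<^esub> inv\<^bsub>A\<^esub> f (g \<otimes>\<^bsub>G\<^esub> h) \<otimes>\<^bsub>A\<^esub> f g)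
       (carrier G \<times> carrier G)"

definition coboundary2 ::
  "('a, 'b) monoid_scheme \<Rightarrow> 'c monoid \<Rightarrow> ('a \<times> 'a \<Rightarrow> 'c) \<Rightarrow> ('a \<times> 'a \<times> 'a \<Rightarrow> 'c)" where
  "coboundary2 G A c =
     restrict (\<lambda>(g, h, k). c (h, k) \<otimes>\<^bsub>A\<^esub> inv\<^bsub>A\<^esub> c (g \<otimes>\<^bsub>G\<^esub> h, k)
                            \<otimes>\<^bsub>A\<^esub> c (g, h \<otimes>\<^bsub>G\<^esub> k) \<otimes>\<^bsub>A\<^esub> inv\<^bsub>A\<^esub> c (g, h))
       (carrier G \<times> carrier G \<times> carrier G)"

text \<open>
  Since the action is trivial, the coboundary of a 0-cochain vanishes, so the first cohomology
  group is the group of 1-cocycles itself, that is, of continuous homomorphisms from \<open>G\<close> to \<open>A\<close>.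
\<close>

definition H1 ::
  "('a, 'b) monoid_scheme \<Rightarrow> 'a topology \<Rightarrow> 'c monoid \<Rightarrow> ('a \<Rightarrow> 'c) monoid" where
  "H1 G T A =
     (cochains1 T A)\<lparr>carrier := kernel (cochains1 T A) (cochains2 T A) (coboundary1 G A)\<rparr>"

definition cocycles2 ::
  "('a, 'b) monoid_scheme \<Rightarrow> 'a topology \<Rightarrow> 'c monoid \<Rightarrow> ('a \<times> 'a \<Rightarrow> 'c) monoid" where
  "cocycles2 G T A =
     (cochains2 T A)\<lparr>carrier := kernel (cochains2 T A) (cochains3 T A) (coboundary2 G A)\<rparr>"

definition coboundaries2 ::
  "('a, 'b) monoid_scheme \<Rightarrow> 'a topology \<Rightarrow> 'c monoid \<Rightarrow> ('a \<times> 'a \<Rightarrow> 'c) set" where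
  "coboundaries2 G T A = coboundary1 G A ` carrier (cochains1 T A)"

definition H2 ::
  "('a, 'b) monoid_scheme \<Rightarrow> 'a topology \<Rightarrow> 'c monoid \<Rightarrow> ('a \<times> 'a \<Rightarrow> 'c) set monoid" where
  "H2 G T A = cocycles2 G T A Mod coboundaries2 G T A"

text \<open>
  The connecting homomorphism in degree 1 of an exact sequence of trivial modules
  \<open>1 \<rightarrow> A \<rightarrow> B \<rightarrow> C \<rightarrow> 1\<close> with maps \<open>i\<close> and \<open>p\<close>: lift \<open>\<psi>\<close> to a cochain \<open>\<phi>\<close> with values in \<open>B\<close>, and
  pull its coboundary back along \<open>i\<close>. Two lifts of \<open>\<psi>\<close> differ by a cochain with values in \<open>A\<close>,
  hence the cocycles \<open>c\<close> obtained from all lifts form exactly one coset of the coboundaries.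
\<close>

definition connecting_hom ::
  "('a, 'b) monoid_scheme \<Rightarrow> 'a topology \<Rightarrow> 'c monoid \<Rightarrow> 'd monoid \<Rightarrow> ('c \<Rightarrow> 'd) \<Rightarrow> ('d \<Rightarrow> 'e)
    \<Rightarrow> ('a \<Rightarrow> 'e) \<Rightarrow> ('a \<times> 'a \<Rightarrow> 'c) set" where
  "connecting_hom G T A B i p \<psi> =
     {c \<in> carrier (cochains2 T A). \<exists>\<phi> \<in> carrier (cochains1 T B).
        (\<forall>g \<in> carrier G. p (\<phi> g) = \<psi> g) \<and>
        (\<forall>x \<in> carrier G \<times> carrier G. i (c x) = coboundary1 G B \<phi> x)}"

text \<open>
  Here \<open>integer_mod_group n\<close> has the carrier \<open>{0..<n}\<close>, so that multiplication by 2 and reduction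
  modulo 2 are the maps of the sequence \<open>0 \<rightarrow> \<int>/2 \<rightarrow> \<int>/4 \<rightarrow> \<int>/2 \<rightarrow> 0\<close>.
\<close>

definition bockstein ::
  "('a, 'b) monoid_scheme \<Rightarrow> 'a topology \<Rightarrow> ('a \<Rightarrow> int) \<Rightarrow> ('a \<times> 'a \<Rightarrow> int) set" where
  "bockstein G T =
     connecting_hom G T (integer_mod_group 2) (integer_mod_group 4) (\<lambda>x. 2 * x) (\<lambda>x. x mod 2)"

definition cup ::
  "('a, 'b) monoid_scheme \<Rightarrow> 'a topology \<Rightarrow> ('a \<Rightarrow> int) \<Rightarrow> ('a \<Rightarrow> int) \<Rightarrow> ('a \<times> 'a \<Rightarrow> int) set" where
  "cup G T \<psi> \<psi>' =
     coboundaries2 G T (integer_mod_group 2) #>\<^bsub>cocycles2 G T (integer_mod_group 2)\<^esub>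
       restrict (\<lambda>(g, h). \<psi> g * \<psi>' h mod 2) (carrier G \<times> carrier G)"


section \<open>Tensor products of abelian groups\<close>

definition tensor_relations ::
  "('a, 'm) monoid_scheme \<Rightarrow> ('b, 'n) monoid_scheme \<Rightarrow> ('a \<times> 'b \<Rightarrow>\<^sub>0 int) set" where
  "tensor_relations A B = generate (free_Abelian_group (carrier A \<times> carrier B))
     ({frag_of (a \<otimes>\<^bsub>A\<^esub> a', b) - frag_of (a, b) - frag_of (a', b) | a a' b.
         a \<in> carrier A \<and> a' \<in> carrier A \<and> b \<in> carrier B} \<union>
      {frag_of (a, b \<otimes>\<^bsub>B\<^esub> b') - frag_of (a, b) - frag_of (a, b') | a b b'.
         a \<in> carrier A \<and> b \<in> carrier B \<and> b' \<in> carrier B})"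

definition tensor_product ::
  "('a, 'm) monoid_scheme \<Rightarrow> ('b, 'n) monoid_scheme \<Rightarrow> ('a \<times> 'b \<Rightarrow>\<^sub>0 int) set monoid" where
  "tensor_product A B =
     free_Abelian_group (carrier A \<times> carrier B) Mod tensor_relations A B"

definition pure_tensor ::
  "('a, 'm) monoid_scheme \<Rightarrow> ('b, 'n) monoid_scheme \<Rightarrow> 'a \<Rightarrow> 'b \<Rightarrow> ('a \<times> 'b \<Rightarrow>\<^sub>0 int) set" where
  "pure_tensor A B a b =
     tensor_relations A B #>\<^bsub>free_Abelian_group (carrier A \<times> carrier B)\<^esub> frag_of (a, b)"

text \<open>
  The homomorphism on the tensor product induced by a bilinear map \<open>f\<close> into an abelian group \<open>C\<close>:
  the linear extension of \<open>f\<close> to formal sums is constant on the cosets of the relations.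
\<close>

definition tensor_lift ::
  "('c, 'm) monoid_scheme \<Rightarrow> ('a \<Rightarrow> 'b \<Rightarrow> 'c) \<Rightarrow> ('a \<times> 'b \<Rightarrow>\<^sub>0 int) set \<Rightarrow> 'c" where
  "tensor_lift C f K =
     the_elem ((\<lambda>t. finprod C (\<lambda>(a, b). f a b [^]\<^bsub>C\<^esub> Poly_Mapping.lookup t (a, b))
                       (Poly_Mapping.keys t)) ` K)"


section \<open>Galois relation type relative to 2\<close>

definition galois_relation_type :: "('a, 'b) monoid_scheme \<Rightarrow> 'a topology \<Rightarrow> bool" where
  "galois_relation_type G T \<longleftrightarrow>
     (let H\<^sub>1 = H1 G T (integer_mod_group 2);
          H\<^sub>2 = H2 G T (integer_mod_group 2)
      in (\<exists>S \<subseteq> {pure_tensor H\<^sub>1 H\<^sub>1 \<psi> \<psi>' | \<psi> \<psi>'. \<psi> \<in> carrier H\<^sub>1 \<and> \<psi>' \<in> carrier H\<^sub>1}.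
            kernel (tensor_product H\<^sub>1 H\<^sub>1) H\<^sub>2 (tensor_lift H\<^sub>2 (cup G T))
              = generate (tensor_product H\<^sub>1 H\<^sub>1) S) \<and>
         (\<exists>\<xi> \<in> carrier H\<^sub>1. \<forall>\<psi> \<in> carrier H\<^sub>1.
            cup G T \<psi> \<xi> \<otimes>\<^bsub>H\<^sub>2\<^esub> bockstein G T \<psi> = \<one>\<^bsub>H\<^sub>2\<^esub>))"


section \<open>The dihedral group of order 8\<close>

text \<open>The pair \<open>(i, a)\<close> stands for \<open>r\<^sup>i s\<^sup>a\<close>, so that \<open>r = (1, 0)\<close> and \<open>s = (0, 1)\<close>.\<close>

definition D4 :: "(int \<times> int) monoid" where
  "D4 = \<lparr>carrier = {0..<4} \<times> {0..<2},
         monoid.mult = (\<lambda>(i, a) (j, b). ((if a = 0 then i + j else i - j) mod 4, (a + b) mod 2)),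
         one = (0, 0)\<rparr>"

text \<open>
  The following facts say that \<open>D4\<close> is presented by the generators \<open>r\<close>, \<open>s\<close> and the relations
  \<open>r\<^sup>4 = s\<^sup>2 = (r s)\<^sup>2 = 1\<close>.
\<close>

lemma group_D4: "group D4"
proof (rule groupI)
  fix x assume "x \<in> carrier D4"
  then obtain i a where x: "x = (i, a)" "0 \<le> i" "i < 4" "0 \<le> a" "a < 2"
    by (auto simp: D4_def)
  show "\<exists>y\<in>carrier D4. y \<otimes>\<^bsub>D4\<^esub> x = \<one>\<^bsub>D4\<^esub>"
  proof (cases "a = 0")
    case True
    then show ?thesis
      using x by (intro bexI[of _ "((-i) mod 4, 0)"]) (auto simp: D4_def mod_simps)
  next
    case False
    then have "a = 1" using x by auto
    then show ?thesis
      using x by (intro bexI[of _ "(i, 1)"]) (auto simp: D4_def mod_simps)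
  qed
next
  fix x y z assume "x \<in> carrier D4" "y \<in> carrier D4" "z \<in> carrier D4"
  then obtain i a j b k c where xyz: "x = (i, a)" "y = (j, b)" "z = (k, c)"
    and "0 \<le> a" "a < 2" "0 \<le> b" "b < 2" "0 \<le> c" "c < 2"
    by (auto simp: D4_def)
  then have "a = 0 \<or> a = 1" "b = 0 \<or> b = 1" "c = 0 \<or> c = 1" by auto
  then show "x \<otimes>\<^bsub>D4\<^esub> y \<otimes>\<^bsub>D4\<^esub> z = x \<otimes>\<^bsub>D4\<^esub> (y \<otimes>\<^bsub>D4\<^esub> z)"
    using xyz by (auto simp: D4_def mod_simps algebra_simps)
qed (auto simp: D4_def)

lemma D4_relations:
  "(1, 0) [^]\<^bsub>D4\<^esub> (4::nat) = \<one>\<^bsub>D4\<^esub>"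
  "(0, 1) [^]\<^bsub>D4\<^esub> (2::nat) = \<one>\<^bsub>D4\<^esub>"
  "((1, 0) \<otimes>\<^bsub>D4\<^esub> (0, 1)) [^]\<^bsub>D4\<^esub> (2::nat) = \<one>\<^bsub>D4\<^esub>"
  by (simp_all add: nat_pow_def D4_def eval_nat_numeral)

lemma D4_normal_form:
  assumes "(i, a) \<in> carrier D4"
  shows "(i, a) = (1, 0) [^]\<^bsub>D4\<^esub> nat i \<otimes>\<^bsub>D4\<^esub> (0, 1) [^]\<^bsub>D4\<^esub> nat a"
proof -
  have "i \<in> {0, 1, 2, 3}" "a \<in> {0, 1}" using assms by (auto simp: D4_def)
  then show ?thesis
    by (auto simp: D4_def nat_pow_def eval_nat_numeral)
qed

lemma D4_universal:
  assumes "group H" "x \<in> carrier H" "y \<in> carrier H"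
    and x4: "x [^]\<^bsub>H\<^esub> (4::nat) = \<one>\<^bsub>H\<^esub>"
    and y2: "y [^]\<^bsub>H\<^esub> (2::nat) = \<one>\<^bsub>H\<^esub>"
    and xy2: "(x \<otimes>\<^bsub>H\<^esub> y) [^]\<^bsub>H\<^esub> (2::nat) = \<one>\<^bsub>H\<^esub>"
  shows "\<exists>f \<in> hom D4 H. f (1, 0) = x \<and> f (0, 1) = y"
proof -
  interpret H: group H by fact
  note [simp] = assms(2,3)
  define f where "f = (\<lambda>(i::int, a::int). x [^]\<^bsub>H\<^esub> i \<otimes>\<^bsub>H\<^esub> y [^]\<^bsub>H\<^esub> a)"
  have x4': "x [^]\<^bsub>H\<^esub> (4::int) = \<one>\<^bsub>H\<^esub>" and y2': "y [^]\<^bsub>H\<^esub> (2::int) = \<one>\<^bsub>H\<^esub>"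
    using x4 y2 by (simp_all flip: int_pow_int)
  have xmod: "x [^]\<^bsub>H\<^esub> (i mod 4) = x [^]\<^bsub>H\<^esub> i" for i :: int
  proof -
    have "x [^]\<^bsub>H\<^esub> (4 * (i div 4) + i mod 4) = x [^]\<^bsub>H\<^esub> (i mod 4)"
      by (subst H.int_pow_mult) (simp_all flip: H.int_pow_pow add: x4')
    then show ?thesis by simp
  qed
  have ymod: "y [^]\<^bsub>H\<^esub> (i mod 2) = y [^]\<^bsub>H\<^esub> i" for i :: int
  proof -
    have "y [^]\<^bsub>H\<^esub> (2 * (i div 2) + i mod 2) = y [^]\<^bsub>H\<^esub> (i mod 2)"
      by (subst H.int_pow_mult) (simp_all flip: H.int_pow_pow add: y2')
    then show ?thesis by simp
  qed
  have yy: "y \<otimes>\<^bsub>H\<^esub> y = \<one>\<^bsub>H\<^esub>" using y2 by (simp add: numeral_2_eq_2)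
  have xyxy: "x \<otimes>\<^bsub>H\<^esub> y \<otimes>\<^bsub>H\<^esub> (x \<otimes>\<^bsub>H\<^esub> y) = \<one>\<^bsub>H\<^esub>" using xy2 by (simp add: numeral_2_eq_2)
  have invy: "inv\<^bsub>H\<^esub> y = y" using yy by (simp add: H.inv_equality)
  have conj: "y \<otimes>\<^bsub>H\<^esub> x \<otimes>\<^bsub>H\<^esub> y = inv\<^bsub>H\<^esub> x"
    using xyxy by (metis H.inv_equality H.inv_comm H.m_assoc H.m_closed assms(2,3))
  have yx: "y \<otimes>\<^bsub>H\<^esub> x [^]\<^bsub>H\<^esub> j = x [^]\<^bsub>H\<^esub> (- j) \<otimes>\<^bsub>H\<^esub> y" for j :: int
  proof -
    have "y \<otimes>\<^bsub>H\<^esub> x [^]\<^bsub>H\<^esub> n \<otimes>\<^bsub>H\<^esub> y = (inv\<^bsub>H\<^esub> x) [^]\<^bsub>H\<^esub> n" for n :: nat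
    proof (induction n)
      case 0 then show ?case by (simp add: yy)
    next
      case (Suc n)
      have "y \<otimes>\<^bsub>H\<^esub> x [^]\<^bsub>H\<^esub> Suc n \<otimes>\<^bsub>H\<^esub> y
          = (y \<otimes>\<^bsub>H\<^esub> x [^]\<^bsub>H\<^esub> n \<otimes>\<^bsub>H\<^esub> y) \<otimes>\<^bsub>H\<^esub> (y \<otimes>\<^bsub>H\<^esub> x \<otimes>\<^bsub>H\<^esub> y)"
        by (simp add: H.m_assoc H.inv_solve_left' invy)
           (metis H.l_one H.m_assoc H.m_closed H.nat_pow_closed assms(2,3) yy)
      also have "\<dots> = (inv\<^bsub>H\<^esub> x) [^]\<^bsub>H\<^esub> Suc n" by (simp add: Suc conj)
      finally show ?case .
    qed
    then have pos: "y \<otimes>\<^bsub>H\<^esub> x [^]\<^bsub>H\<^esub> int n \<otimes>\<^bsub>H\<^esub> y = x [^]\<^bsub>H\<^esub> (- int n)" for n :: nat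
      by (simp add: int_pow_int H.int_pow_neg H.nat_pow_inv)
    have "x [^]\<^bsub>H\<^esub> j = x [^]\<^bsub>H\<^esub> int (nat (j mod 4))" by (simp add: xmod)
    moreover have "x [^]\<^bsub>H\<^esub> (- int (nat (j mod 4))) = x [^]\<^bsub>H\<^esub> (- j)"
      by (simp add: H.int_pow_neg xmod)
    ultimately have "y \<otimes>\<^bsub>H\<^esub> x [^]\<^bsub>H\<^esub> j \<otimes>\<^bsub>H\<^esub> y = x [^]\<^bsub>H\<^esub> (- j)"
      using pos[of "nat (j mod 4)"] by argo
    then show ?thesis
      by (metis H.int_pow_closed H.m_assoc H.m_closed H.r_one assms(2,3) yy)
  qed
  have "f \<in> hom D4 H"
  proof (rule homI)
    fix u v assume "u \<in> carrier D4" "v \<in> carrier D4"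
    then obtain i a j b where uv: "u = (i, a)" "v = (j, b)" "a = 0 \<or> a = 1" "b = 0 \<or> b = 1"
      by (force simp: D4_def)
    show "f (u \<otimes>\<^bsub>D4\<^esub> v) = f u \<otimes>\<^bsub>H\<^esub> f v"
    proof (cases "a = 0")
      case True
      then show ?thesis using uv
        by (simp add: f_def D4_def xmod ymod H.int_pow_mult H.m_assoc)
    next
      case False
      then have a: "a = 1" using uv by simp
      have "f u \<otimes>\<^bsub>H\<^esub> f v = x [^]\<^bsub>H\<^esub> i \<otimes>\<^bsub>H\<^esub> (y \<otimes>\<^bsub>H\<^esub> x [^]\<^bsub>H\<^esub> j) \<otimes>\<^bsub>H\<^esub> y [^]\<^bsub>H\<^esub> b"
        using uv a by (simp add: f_def H.m_assoc)
      also have "\<dots> = x [^]\<^bsub>H\<^esub> (i + - j) \<otimes>\<^bsub>H\<^esub> y [^]\<^bsub>H\<^esub> (1 + b)"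
        unfolding yx by (simp add: H.int_pow_mult H.m_assoc del: add_uminus_conv_diff)
      also have "\<dots> = f (u \<otimes>\<^bsub>D4\<^esub> v)"
        using uv a by (simp add: f_def D4_def xmod ymod)
      finally show ?thesis ..
    qed
  qed (auto simp: f_def)
  moreover have "f (1, 0) = x" "f (0, 1) = y" by (simp_all add: f_def)
  ultimately show ?thesis by blast
qed

end

theory Submission
  imports Defs
begin

text \<open>
  Write \<open>D i\<close> for the terms of the descending 2-central series. In each of the groups \<open>1\<close>, \<open>\<int>/2\<close>,
  \<open>\<int>/4\<close>, \<open>D4\<close> all squares and commutators are central of order at most 2, so the third term of its own
  series is trivial; hence \<open>D 3\<close> is contained in every \<open>N\<close> (\<open>D3_subset\<close>).

  For the converse let \<open>g\<close> lie in every \<open>N\<close>. The quotients \<open>\<int>/2\<close> already force \<open>g\<close> into \<open>D 2\<close>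
  (\<open>in_D2\<close>). Suppose that \<open>g\<close> is not in \<open>D 3\<close>. An open normal subgroup \<open>U\<close> which contains
  \<open>D 3\<close> and is maximal with respect to avoiding \<open>g\<close> satisfies \<open>D 2 \<subseteq> U \<union> U g\<close>, so in the finite group
  \<open>Q = G/U\<close> all squares and commutators are \<open>1\<close> or the class \<open>z\<close> of \<open>g\<close>. On such a group there is
  a function \<open>f\<close> with values modulo 2 which is \<open>1\<close> at \<open>z\<close> and whose coboundary is a finite sum
  of products \<open>\<psi>\<^sub>i(x) \<psi>\<^sub>i'(y)\<close> of characters (\<open>quadratic_on_carrier\<close>). In terms of cochains, this combines two facts:
  the transgression sends the character of \<open>D 2\<close> that is nontrivial at \<open>g\<close> into the second cohomology of an
  elementary abelian 2-group, and that cohomology is generated by cup products.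

  Pulled back to \<open>G\<close>, the coboundary of \<open>f\<close> shows that \<open>\<Sum>\<^sub>i \<psi>\<^sub>i \<otimes> \<psi>\<^sub>i'\<close> lies in the kernel of the cup product.
  By the hypothesis on \<open>G\<close> it is a combination of pure tensors \<open>\<psi> \<otimes> \<psi>'\<close> for which \<open>\<psi>(x) \<psi>'(y)\<close>
  is itself the coboundary of some cochain \<open>h\<close>. The triple \<open>(\<psi>, \<psi>', h)\<close> is the same as
  a homomorphism from \<open>G\<close> to the unitriangular 3 by 3 matrices over the field with two elements, which form
  a group isomorphic to \<open>D4\<close>. It is onto when \<open>\<psi>\<close> and \<open>\<psi>'\<close> are distinct and nonzero; for
  \<open>\<psi> = \<psi>' \<noteq> 0\<close> its image is a cyclic group of order 4, and if one of the two characters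
  vanishes, then \<open>h\<close> is a character. In each case the assumption on \<open>g\<close> gives \<open>h(g) = 0\<close>
  (\<open>vanishing_on_intersection_of_kernels\<close>). Adding up these cochains produces a cochain with the same coboundary
  as \<open>f\<close> that vanishes at \<open>g\<close> (\<open>cochain_vanishing_of_pure_tensors\<close>). Its difference from \<open>f\<close> is a continuous character
  of \<open>G\<close> that is nontrivial at \<open>g \<in> D 2\<close>, whereas all characters are trivial on \<open>D 2\<close>.
\<close>

section \<open>Open normal subgroups of profinite groups\<close>

context profinite_group
begin

lemma continuous_map_mult:
  assumes "continuous_map Y T f" "continuous_map Y T g"
  shows "continuous_map Y T (\<lambda>x. f x \<otimes> g x)"
proof -
  have "continuous_map Y (prod_topology T T) (\<lambda>x. (f x, g x))"
    using assms by (simp add: continuous_map_pairedI)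
  from continuous_map_compose[OF this continuous_mult] show ?thesis
    by (simp add: o_def)
qed

lemma continuous_map_right_mult: "x \<in> carrier G \<Longrightarrow> continuous_map T T (\<lambda>y. y \<otimes> x)"
  by (intro continuous_map_mult) (auto simp: topspace_eq)

lemma continuous_map_left_mult: "x \<in> carrier G \<Longrightarrow> continuous_map T T (\<lambda>y. x \<otimes> y)"
  by (intro continuous_map_mult) (auto simp: topspace_eq)

text \<open>
  In a compact Hausdorff space the components are the quasi-components, so a point whose component is
  a singleton can be separated from any closed set by a clopen set.
\<close>

lemma clopen_neighbourhood:
  assumes "openin T W" "x \<in> W"
  obtains V where "closedin T V" "openin T V" "x \<in> V" "V \<subseteq> W"
proof -
  have x: "x \<in> topspace T" using assms openin_subset by blast
  have "quasi_component_of_set T x = {x}"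
    using totally_disconnected x quasi_eq_connected_component_of compact Hausdorff
    by (metis topspace_eq)
  then have "{x} \<in> quasi_components_of T"
    using quasi_component_in_quasi_components_of x by metis
  moreover have "compactin T (topspace T - W)"
    using assms(1) compact by (simp add: closedin_compact_space closedin_diff)
  moreover have "disjnt {x} (topspace T - W)" using assms by auto
  ultimately have "separated_between T {x} (topspace T - W)"
    using separated_between_quasi_component_compact by metis
  then obtain V where "closedin T V" "openin T V" "x \<in> V" "topspace T - W \<subseteq> topspace T - V"
    unfolding separated_between by auto
  moreover have "V \<subseteq> topspace T" using \<open>openin T V\<close> by (rule openin_subset)
  ultimately show thesis using that[of V] by blast
qed

text \<open>
  The elements that may be deleted from any product without changing membership in \<open>V\<close> form a
  two-sided stabiliser of \<open>V\<close>. It is a normal subgroup because the deletion is allowed between any two factors,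
  it lies in \<open>V\<close> because \<open>\<one>\<close> does, and compactness makes it open.
\<close>

lemma open_normal_subgroup_in_clopen:
  assumes "closedin T V" "openin T V" "\<one> \<in> V"
  obtains U where "U \<lhd> G" "openin T U" "U \<subseteq> V"
proof -
  define U where "U = {u \<in> carrier G. \<forall>x\<in>carrier G. \<forall>y\<in>carrier G. x \<otimes> u \<otimes> y \<in> V \<longleftrightarrow> x \<otimes> y \<in> V}"
  let ?P = "prod_topology T (prod_topology T T)"
  let ?f = "\<lambda>p. fst (snd p) \<otimes> fst p \<otimes> snd (snd p)" and ?g = "\<lambda>p. fst (snd p) \<otimes> snd (snd p)"
  have p1: "continuous_map ?P T fst" by (rule continuous_map_fst)
  have p2: "continuous_map ?P T (\<lambda>p. fst (snd p))"
    using continuous_map_compose[OF continuous_map_snd continuous_map_fst] by (simp add: o_def)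
  have p3: "continuous_map ?P T (\<lambda>p. snd (snd p))"
    using continuous_map_compose[OF continuous_map_snd continuous_map_snd] by (simp add: o_def)
  have f: "continuous_map ?P T ?f" and g: "continuous_map ?P T ?g"
    by (intro continuous_map_mult p1 p2 p3)+
  have V': "closedin T (topspace T - V)" using assms(2) by blast
  \<comment> \<open>The complement of \<open>U\<close> is the projection of the clopen set \<open>B\<close> along a compact factor,
  hence closed.\<close>
  define B where "B = ({p \<in> topspace ?P. ?f p \<in> V} \<inter> {p \<in> topspace ?P. ?g p \<in> topspace T - V})
      \<union> ({p \<in> topspace ?P. ?f p \<in> topspace T - V} \<inter> {p \<in> topspace ?P. ?g p \<in> V})"
  have "closedin ?P B" unfolding B_def
    by (intro closedin_Un closedin_Int closedin_continuous_map_preimage[OF f]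
          closedin_continuous_map_preimage[OF g] assms(1) V')
  then have "closedin T (fst ` B)"
    using closed_map_fst[of "prod_topology T T" T] compact
    by (simp add: compact_space_prod_topology closed_map_def)
  moreover have "U = topspace T - fst ` B"
  proof -
    have "u \<in> fst ` B \<longleftrightarrow> (\<exists>x\<in>carrier G. \<exists>y\<in>carrier G. \<not> (x \<otimes> u \<otimes> y \<in> V \<longleftrightarrow> x \<otimes> y \<in> V))"
      if u: "u \<in> carrier G" for u
    proof
      assume "u \<in> fst ` B"
      then obtain x y where "(u, x, y) \<in> B" by auto
      then show "\<exists>x\<in>carrier G. \<exists>y\<in>carrier G. \<not> (x \<otimes> u \<otimes> y \<in> V \<longleftrightarrow> x \<otimes> y \<in> V)"
        by (auto simp: B_def topspace_eq)
    next
      assume "\<exists>x\<in>carrier G. \<exists>y\<in>carrier G. \<not> (x \<otimes> u \<otimes> y \<in> V \<longleftrightarrow> x \<otimes> y \<in> V)"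
      then obtain x y where "x \<in> carrier G" "y \<in> carrier G" "\<not> (x \<otimes> u \<otimes> y \<in> V \<longleftrightarrow> x \<otimes> y \<in> V)"
        by blast
      then have "(u, x, y) \<in> B" using u by (auto simp: B_def topspace_eq)
      then show "u \<in> fst ` B" by force
    qed
    then show ?thesis by (auto simp: U_def topspace_eq)
  qed
  ultimately have "openin T U" by auto
  have UG: "u \<in> carrier G" if "u \<in> U" for u using that by (simp add: U_def)
  have drop: "x \<otimes> u \<otimes> y \<in> V \<longleftrightarrow> x \<otimes> y \<in> V" if "u \<in> U" "x \<in> carrier G" "y \<in> carrier G" for u x y
    using that unfolding U_def by blast
  have UI: "u \<in> U" if "u \<in> carrier G"
    "\<And>x y. x \<in> carrier G \<Longrightarrow> y \<in> carrier G \<Longrightarrow> x \<otimes> u \<otimes> y \<in> V \<longleftrightarrow> x \<otimes> y \<in> V" for u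
    using that unfolding U_def by blast
  have "subgroup U G"
  proof (rule subgroupI)
    have "\<one> \<in> U" by (rule UI) auto
    then show "U \<noteq> {}" by blast
    fix a assume a: "a \<in> U"
    show "inv a \<in> U"
    proof (rule UI)
      fix x y assume xy: "x \<in> carrier G" "y \<in> carrier G"
      then have "(x \<otimes> inv a) \<otimes> a \<otimes> y \<in> V \<longleftrightarrow> (x \<otimes> inv a) \<otimes> y \<in> V"
        using a UG by (intro drop) auto
      moreover have "(x \<otimes> inv a) \<otimes> a = x" using a UG xy by (simp add: m_assoc)
      ultimately show "x \<otimes> inv a \<otimes> y \<in> V \<longleftrightarrow> x \<otimes> y \<in> V" by simp
    qed (use a UG in simp)
    fix b assume b: "b \<in> U"
    show "a \<otimes> b \<in> U"
    proof (rule UI)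
      fix x y assume xy: "x \<in> carrier G" "y \<in> carrier G"
      then have "(x \<otimes> a) \<otimes> b \<otimes> y \<in> V \<longleftrightarrow> (x \<otimes> a) \<otimes> y \<in> V"
        using a b UG by (intro drop) auto
      also have "\<dots> \<longleftrightarrow> x \<otimes> y \<in> V" using a xy by (rule drop)
      finally show "x \<otimes> (a \<otimes> b) \<otimes> y \<in> V \<longleftrightarrow> x \<otimes> y \<in> V"
        using a b xy UG by (simp add: m_assoc)
    qed (use a b UG in simp)
  qed (use UG in blast)
  moreover have "c \<otimes> u \<otimes> inv c \<in> U" if c: "c \<in> carrier G" and u: "u \<in> U" for c u
  proof (rule UI)
    fix x y assume xy: "x \<in> carrier G" "y \<in> carrier G"
    then have "(x \<otimes> c) \<otimes> u \<otimes> (inv c \<otimes> y) \<in> V \<longleftrightarrow> (x \<otimes> c) \<otimes> (inv c \<otimes> y) \<in> V"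
      using c u by (intro drop) auto
    moreover have "(x \<otimes> c) \<otimes> (inv c \<otimes> y) = x \<otimes> y"
      using c xy by (metis inv_closed m_assoc m_closed r_inv r_one)
    ultimately show "x \<otimes> (c \<otimes> u \<otimes> inv c) \<otimes> y \<in> V \<longleftrightarrow> x \<otimes> y \<in> V"
      using c u xy UG by (simp add: m_assoc)
  qed (use c u UG in simp)
  ultimately have "U \<lhd> G" by (simp add: normal_inv_iff)
  moreover have "U \<subseteq> V"
  proof
    fix u assume "u \<in> U"
    then have "u \<in> carrier G" "\<one> \<otimes> u \<otimes> \<one> \<in> V \<longleftrightarrow> \<one> \<otimes> \<one> \<in> V" unfolding U_def by blast+
    then show "u \<in> V" using assms(3) by simp
  qed
  ultimately show thesis using that \<open>openin T U\<close> by blast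
qed

lemma openin_r_coset:
  assumes "openin T U" "U \<subseteq> carrier G" "x \<in> carrier G"
  shows "openin T (U #> x)"
proof -
  have "U #> x = {y \<in> topspace T. y \<otimes> inv x \<in> U}"
    using assms(2,3) by (force simp: r_coset_def topspace_eq m_assoc)
  then show ?thesis
    using openin_continuous_map_preimage[OF continuous_map_right_mult[of "inv x"] assms(1)] assms(3) by simp
qed

lemma open_union_of_cosets:
  assumes "openin T U" "subgroup U G" "S \<subseteq> carrier G" "\<And>s. s \<in> S \<Longrightarrow> U #> s \<subseteq> S"
  shows "openin T S"
proof -
  have U: "U \<subseteq> carrier G" using assms(2) subgroup.subset by blast
  have "S = (\<Union>s\<in>S. U #> s)"
  proof (intro equalityI subsetI)
    fix x assume "x \<in> S"
    then show "x \<in> (\<Union>s\<in>S. U #> s)" using assms(2,3) rcos_self by blast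
  qed (use assms(4) in blast)
  moreover have "openin T (\<Union>s\<in>S. U #> s)"
    using openin_r_coset[OF assms(1) U] assms(3) by (intro openin_Union) auto
  ultimately show ?thesis by simp
qed

lemma finite_rcosets_open:
  assumes "openin T U" "subgroup U G"
  shows "finite (rcosets U)"
proof -
  have U: "U \<subseteq> carrier G" using assms(2) subgroup.subset by blast
  have "\<forall>C\<in>rcosets U. openin T C" using openin_r_coset[OF assms(1) U] by (auto simp: RCOSETS_def)
  moreover have un: "\<Union>(rcosets U) = carrier G" using assms(2) by (rule rcosets_part_G)
  ultimately obtain F where F: "finite F" "F \<subseteq> rcosets U" "topspace T \<subseteq> \<Union>F"
    using compact unfolding compact_space_def compactin_def topspace_eq
    by (metis subset_refl)
  have "rcosets U \<subseteq> F"
  proof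
    fix C assume C: "C \<in> rcosets U"
    then obtain x where x: "x \<in> carrier G" "C = U #> x" by (auto simp: RCOSETS_def)
    then have "x \<in> C" using assms(2) rcos_self by blast
    moreover obtain D where "D \<in> F" "x \<in> D" using F(3) x by (auto simp: topspace_eq)
    moreover have "disjnt C D" if "C \<noteq> D"
      using rcos_disjoint[OF assms(2)] C F(2) that \<open>D \<in> F\<close> by (auto simp: pairwise_def)
    ultimately have "C = D" by (auto simp: disjnt_iff)
    then show "C \<in> F" using \<open>D \<in> F\<close> by simp
  qed
  then show ?thesis using F(1) finite_subset by blast
qed

end

section \<open>The descending 2-central series\<close>

lemma (in group)
  shows mult_inv_cancel_left: "x \<in> carrier G \<Longrightarrow> y \<in> carrier G \<Longrightarrow> x \<otimes> (inv x \<otimes> y) = y"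
    and inv_mult_cancel_left: "x \<in> carrier G \<Longrightarrow> y \<in> carrier G \<Longrightarrow> inv x \<otimes> (x \<otimes> y) = y"
  by (simp_all flip: m_assoc)

lemma (in group_hom) normal_preimage_central_involution:
  assumes k: "k \<in> carrier H" "k \<otimes>\<^bsub>H\<^esub> k = \<one>\<^bsub>H\<^esub>"
    and central: "\<And>x. x \<in> carrier G \<Longrightarrow> h x \<otimes>\<^bsub>H\<^esub> k = k \<otimes>\<^bsub>H\<^esub> h x"
  shows "{x \<in> carrier G. h x = \<one>\<^bsub>H\<^esub> \<or> h x = k} \<lhd> G" (is "?N \<lhd> G")
proof -
  have inv_k: "inv\<^bsub>H\<^esub> k = k" using k by (metis H.inv_equality)
  have "subgroup ?N G"
  proof (rule G.subgroupI)
    show "?N \<noteq> {}" by (auto intro!: exI[of _ "\<one>"])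
  qed (use k inv_k in auto)
  moreover have "x \<otimes> a \<otimes> inv x \<in> ?N" if "x \<in> carrier G" "a \<in> ?N" for x a
  proof -
    have "h (x \<otimes> a \<otimes> inv x) = h x \<otimes>\<^bsub>H\<^esub> h a \<otimes>\<^bsub>H\<^esub> inv\<^bsub>H\<^esub> h x" using that by auto
    also have "\<dots> = h a"
    proof (cases "h a = k")
      case True
      then show ?thesis using that central[of x] k by (simp add: H.m_assoc)
    qed (use that in auto)
    finally show ?thesis using that by auto
  qed
  ultimately show ?thesis by (simp add: G.normal_inv_iff)
qed

context group
begin

lemma r_coset_eq_iff:
  assumes "subgroup U G" "x \<in> carrier G" "y \<in> carrier G"
  shows "U #> x = U #> y \<longleftrightarrow> x \<in> U #> y"
  using assms repr_independence rcos_self by metis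

lemma r_coset_eq_subgroup_iff:
  assumes "subgroup U G" "x \<in> carrier G"
  shows "U #> x = U \<longleftrightarrow> x \<in> U"
  using assms coset_join1 coset_join2 by metis

text \<open>
  The class of \<open>h\<close> in the quotient by \<open>U\<close> is central of order at most 2, and \<open>U \<union> U h\<close> is the preimage of
  the subgroup that it generates.
\<close>

lemma normal_Un_coset:
  assumes U: "U \<lhd> G" and h: "h \<in> carrier G" "h \<otimes> h \<in> U"
    and comm: "\<And>x. x \<in> carrier G \<Longrightarrow> inv h \<otimes> inv x \<otimes> h \<otimes> x \<in> U"
  shows "U \<union> (U #> h) \<lhd> G"
proof -
  interpret U: normal U G by (rule U)
  interpret Q: group "G Mod U" by (rule U.factorgroup_is_group)
  interpret \<pi>: group_hom G "G Mod U" "\<lambda>x. U #> x"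
    by unfold_locales (rule U.r_coset_hom_Mod)
  note sub = U.subgroup_axioms
  have "(U #> x) \<otimes>\<^bsub>G Mod U\<^esub> (U #> h) = (U #> h) \<otimes>\<^bsub>G Mod U\<^esub> (U #> x)" if x: "x \<in> carrier G" for x
  proof -
    have "h \<otimes> x = (x \<otimes> h) \<otimes> (inv h \<otimes> inv x \<otimes> h \<otimes> x)"
      using x h by (simp add: m_assoc mult_inv_cancel_left inv_mult_cancel_left)
    moreover have "U #> (inv h \<otimes> inv x \<otimes> h \<otimes> x) = \<one>\<^bsub>G Mod U\<^esub>"
      using comm[OF x] by (simp add: coset_join2[OF _ sub])
    ultimately have "U #> (h \<otimes> x) = (U #> (x \<otimes> h)) \<otimes>\<^bsub>G Mod U\<^esub> \<one>\<^bsub>G Mod U\<^esub>"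
      using x h \<pi>.hom_mult[of "x \<otimes> h" "inv h \<otimes> inv x \<otimes> h \<otimes> x"] by (metis inv_closed m_closed)
    then have "U #> (h \<otimes> x) = U #> (x \<otimes> h)"
      using x h Q.r_one[OF \<pi>.hom_closed[of "x \<otimes> h"]] by simp
    then show ?thesis using x h \<pi>.hom_mult by metis
  qed
  moreover have "(U #> h) \<otimes>\<^bsub>G Mod U\<^esub> (U #> h) = \<one>\<^bsub>G Mod U\<^esub>"
    using h \<pi>.hom_mult[OF h(1) h(1)] coset_join2[OF _ sub h(2)] by simp
  ultimately have "{x \<in> carrier G. U #> x = \<one>\<^bsub>G Mod U\<^esub> \<or> U #> x = U #> h} \<lhd> G"
    using \<pi>.normal_preimage_central_involution[OF \<pi>.hom_closed[OF h(1)]] by metis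
  moreover have "{x \<in> carrier G. U #> x = \<one>\<^bsub>G Mod U\<^esub> \<or> U #> x = U #> h} = U \<union> (U #> h)"
    using r_coset_eq_iff[OF sub _ h(1)] r_coset_eq_subgroup_iff[OF sub] U.subset
      r_coset_subset_G[OF U.subset h(1)] by auto
  ultimately show ?thesis by simp
qed

end

context profinite_group
begin

lemma closed_subgroup_generated:
  assumes "S \<subseteq> carrier G"
  shows "subgroup (closed_subgroup_generated G T S) G"
    and "closedin T (closed_subgroup_generated G T S)"
    and subset_closed_subgroup_generated: "S \<subseteq> closed_subgroup_generated G T S"
proof -
  have "carrier G \<in> {H. subgroup H G \<and> closedin T H \<and> S \<subseteq> H}"
    using assms subgroup_self closedin_topspace[of T] by (simp add: topspace_eq)
  then have ne: "{H. subgroup H G \<and> closedin T H \<and> S \<subseteq> H} \<noteq> {}" by blast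
  show "subgroup (closed_subgroup_generated G T S) G"
    unfolding closed_subgroup_generated_def by (rule subgroups_Inter) (use ne in auto)
  show "closedin T (closed_subgroup_generated G T S)"
    unfolding closed_subgroup_generated_def by (rule closedin_Inter) (use ne in auto)
qed (auto simp: closed_subgroup_generated_def)

lemma closed_subgroup_generated_minimal:
  assumes "subgroup H G" "closedin T H" "S \<subseteq> H"
  shows "closed_subgroup_generated G T S \<subseteq> H"
  using assms unfolding closed_subgroup_generated_def by blast

abbreviation D where "D \<equiv> descending_central G T"

lemma D_1: "D (Suc 0) = carrier G"
  by (simp add: descending_central_def)

lemma D_Suc: "D (Suc (Suc n)) = closed_subgroup_generated G T
    ({h \<otimes> h | h. h \<in> D (Suc n)} \<union> {inv h \<otimes> inv g \<otimes> h \<otimes> g | h g. h \<in> D (Suc n) \<and> g \<in> carrier G})"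
  by (simp add: descending_central_def)

text \<open>
  Normality of a new term comes from its own generators: it is contained in the previous term, so for each of its
  elements \<open>h\<close> it contains the commutators \<open>[h, x]\<close> and hence the conjugates of \<open>h\<close>.
\<close>

lemma
  shows normal_D: "D (Suc n) \<lhd> G" and closedin_D: "closedin T (D (Suc n))"
    and square_in_D_Suc: "\<And>h. h \<in> D (Suc n) \<Longrightarrow> h \<otimes> h \<in> D (Suc (Suc n))"
    and commutator_in_D_Suc:
      "\<And>h g. h \<in> D (Suc n) \<Longrightarrow> g \<in> carrier G \<Longrightarrow> inv h \<otimes> inv g \<otimes> h \<otimes> g \<in> D (Suc (Suc n))"
proof -
  let ?S = "\<lambda>n. {h \<otimes> h | h. h \<in> D (Suc n)} \<union>
    {inv h \<otimes> inv g \<otimes> h \<otimes> g | h g. h \<in> D (Suc n) \<and> g \<in> carrier G}"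
  have S: "?S n \<subseteq> D (Suc n) \<and> ?S n \<subseteq> D (Suc (Suc n))" if "D (Suc n) \<lhd> G" for n
  proof -
    interpret N: normal "D (Suc n)" G by (rule that)
    have S: "?S n \<subseteq> D (Suc n)"
    proof -
      have "inv h \<otimes> inv g \<otimes> h \<otimes> g \<in> D (Suc n)" if "h \<in> D (Suc n)" "g \<in> carrier G" for h g
      proof -
        have "inv h \<otimes> inv g \<otimes> h \<otimes> g = inv h \<otimes> (inv g \<otimes> h \<otimes> g)"
          using that N.mem_carrier by (simp add: m_assoc)
        then show ?thesis using that N.inv_op_closed1 N.m_closed N.m_inv_closed by metis
      qed
      then show ?thesis using N.m_closed by auto
    qed
    moreover have "?S n \<subseteq> D (Suc (Suc n))"
      unfolding D_Suc by (rule subset_closed_subgroup_generated) (use S N.subset in blast)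
    ultimately show ?thesis by blast
  qed
  have *: "D (Suc n) \<lhd> G \<and> closedin T (D (Suc n))" for n
  proof (induction n)
    case 0
    show ?case using normal_invI[OF subgroup_self] closedin_topspace[of T] by (simp add: D_1 topspace_eq)
  next
    case (Suc n)
    then interpret N: normal "D (Suc n)" G by blast
    have c: "?S n \<subseteq> carrier G" and d: "?S n \<subseteq> D (Suc (Suc n))" using S Suc N.subset by blast+
    have sub: "subgroup (D (Suc (Suc n))) G" and cl: "closedin T (D (Suc (Suc n)))"
      unfolding D_Suc using closed_subgroup_generated[OF c] by blast+
    have le: "D (Suc (Suc n)) \<subseteq> D (Suc n)"
      unfolding D_Suc[of n] using closed_subgroup_generated_minimal[OF N.subgroup_axioms] S Suc by blast
    have "x \<otimes> h \<otimes> inv x \<in> D (Suc (Suc n))" if x: "x \<in> carrier G" and h: "h \<in> D (Suc (Suc n))" for x h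
    proof -
      have hc: "h \<in> carrier G" "h \<in> D (Suc n)" using h le N.subset by blast+
      then have "inv h \<otimes> inv (inv x) \<otimes> h \<otimes> inv x \<in> D (Suc (Suc n))"
        using d x inv_closed by blast
      then have "h \<otimes> (inv h \<otimes> inv (inv x) \<otimes> h \<otimes> inv x) \<in> D (Suc (Suc n))"
        using h sub subgroup.m_closed by metis
      moreover have "h \<otimes> (inv h \<otimes> inv (inv x) \<otimes> h \<otimes> inv x) = x \<otimes> h \<otimes> inv x"
        using x hc by (simp add: m_assoc mult_inv_cancel_left inv_mult_cancel_left)
      ultimately show ?thesis by simp
    qed
    then show ?case using sub cl by (simp add: normal_inv_iff)
  qed
  then show n: "D (Suc n) \<lhd> G" "closedin T (D (Suc n))" by blast+
  from S[OF n(1)] show "\<And>h. h \<in> D (Suc n) \<Longrightarrow> h \<otimes> h \<in> D (Suc (Suc n))"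
    "\<And>h g. h \<in> D (Suc n) \<Longrightarrow> g \<in> carrier G \<Longrightarrow> inv h \<otimes> inv g \<otimes> h \<otimes> g \<in> D (Suc (Suc n))"
    by blast+
qed

text \<open>
  The coset \<open>g U\<close> of a small enough open normal subgroup \<open>U\<close> misses the closed set \<open>C\<close>; the product of
  \<open>C\<close> and \<open>U\<close> then still misses \<open>g\<close>.
\<close>

lemma open_normal_subgroup_avoiding:
  assumes C: "C \<lhd> G" "closedin T C" and g: "g \<in> carrier G" "g \<notin> C"
  obtains U where "U \<lhd> G" "openin T U" "C \<subseteq> U" "g \<notin> U"
proof -
  interpret C: normal C G by (rule C)
  have "openin T {y \<in> topspace T. g \<otimes> y \<in> topspace T - C}"
    by (rule openin_continuous_map_preimage[OF continuous_map_left_mult[OF g(1)]]) (use C(2) in blast)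
  then obtain V where V: "closedin T V" "openin T V" "\<one> \<in> V" "V \<subseteq> {y \<in> topspace T. g \<otimes> y \<in> topspace T - C}"
    by (rule clopen_neighbourhood[where x = \<one>]) (use g in \<open>auto simp: topspace_eq\<close>)
  obtain U where U: "U \<lhd> G" "openin T U" "U \<subseteq> V" by (rule open_normal_subgroup_in_clopen[OF V(1-3)])
  interpret U: normal U G by (rule U(1))
  let ?CU = "C <#> U"
  have sub: "subgroup ?CU G" by (rule mult_norm_subgroup[OF C(1) U.subgroup_axioms])
  have mem: "y \<in> ?CU \<longleftrightarrow> (\<exists>c\<in>C. \<exists>u\<in>U. y = c \<otimes> u)" for y by (auto simp: set_mult_def)
  have "x \<otimes> y \<otimes> inv x \<in> ?CU" if x: "x \<in> carrier G" and y: "y \<in> ?CU" for x y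
  proof -
    obtain c u where cu: "c \<in> C" "u \<in> U" "y = c \<otimes> u" using y mem by blast
    then have "x \<otimes> y \<otimes> inv x = (x \<otimes> c \<otimes> inv x) \<otimes> (x \<otimes> u \<otimes> inv x)"
      using x C.mem_carrier U.mem_carrier by (simp add: m_assoc mult_inv_cancel_left inv_mult_cancel_left)
    then show ?thesis using mem C.inv_op_closed2[OF x cu(1)] U.inv_op_closed2[OF x cu(2)] by blast
  qed
  then have nor: "?CU \<lhd> G" using sub by (simp add: normal_inv_iff)
  have CU: "C \<subseteq> ?CU" "U \<subseteq> ?CU"
    using mem C.one_closed U.one_closed C.mem_carrier U.mem_carrier by (metis l_one r_one subsetI)+
  have "openin T ?CU"
  proof (rule open_union_of_cosets[OF U(2) U.subgroup_axioms subgroup.subset[OF sub]])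
    fix s assume "s \<in> ?CU"
    then show "U #> s \<subseteq> ?CU" using CU(2) subgroup.m_closed[OF sub] by (auto simp: r_coset_def)
  qed
  moreover have "g \<notin> ?CU"
  proof
    assume "g \<in> ?CU"
    then obtain c u where cu: "c \<in> C" "u \<in> U" "g = c \<otimes> u" using mem by blast
    then have "g \<otimes> inv u = c" using C.mem_carrier U.mem_carrier by (simp add: m_assoc)
    moreover have "inv u \<in> V" using cu U(3) U.m_inv_closed by blast
    ultimately show False using V(4) cu(1) by auto
  qed
  ultimately show thesis using that nor CU by blast
qed

text \<open>
  If \<open>U\<close> is maximal among the open normal subgroups that contain \<open>C\<close> but not \<open>g\<close>, then for \<open>h\<close> in \<open>E\<close>
  outside \<open>U\<close> the larger subgroup \<open>U \<union> U h\<close> must contain \<open>g\<close>. This places \<open>E\<close> inside \<open>U \<union> U g\<close>: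
  modulo \<open>U\<close> only the class of \<open>g\<close> is left. A maximal \<open>U\<close> exists because an open subgroup has finite index.
\<close>

lemma maximal_open_normal_subgroup_avoiding:
  assumes C: "C \<lhd> G" "closedin T C" and E: "E \<subseteq> carrier G" and g: "g \<in> E" "g \<notin> C"
    and square: "\<And>h. h \<in> E \<Longrightarrow> h \<otimes> h \<in> C"
    and comm: "\<And>h x. h \<in> E \<Longrightarrow> x \<in> carrier G \<Longrightarrow> inv h \<otimes> inv x \<otimes> h \<otimes> x \<in> C"
  obtains U where "U \<lhd> G" "openin T U" "g \<notin> U" "E \<subseteq> U \<union> (U #> g)"
proof -
  obtain W where W: "W \<lhd> G" "openin T W" "C \<subseteq> W" "g \<notin> W"
    using open_normal_subgroup_avoiding[OF C _ g(2)] g E by blast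
  define F where "F = {U. U \<lhd> G \<and> openin T U \<and> W \<subseteq> U \<and> g \<notin> U}"
  have W': "subgroup W G" using W(1) by (rule normal_imp_subgroup)
  have "F \<subseteq> Union ` Pow (rcosets W)"
  proof
    fix U assume "U \<in> F"
    then have U: "U \<lhd> G" "W \<subseteq> U" by (auto simp: F_def)
    interpret U: normal U G by (rule U(1))
    have "U = \<Union> ((\<lambda>u. W #> u) ` U)"
    proof (intro equalityI subsetI)
      fix x assume "x \<in> U"
      then show "x \<in> \<Union> ((\<lambda>u. W #> u) ` U)" using rcos_self[OF _ W'] U.mem_carrier by blast
    next
      fix x assume "x \<in> \<Union> ((\<lambda>u. W #> u) ` U)"
      then show "x \<in> U" using U(2) U.m_closed by (auto simp: r_coset_def)
    qed
    moreover have "(\<lambda>u. W #> u) ` U \<subseteq> rcosets W" using U.subset by (auto simp: RCOSETS_def)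
    ultimately show "U \<in> Union ` Pow (rcosets W)" by blast
  qed
  then have "finite F" using finite_rcosets_open[OF W(2) W'] by (meson finite_Pow_iff finite_imageI finite_subset)
  moreover have "F \<noteq> {}" using W by (auto simp: F_def)
  ultimately obtain U where "U \<in> F" and max: "\<And>U'. U' \<in> F \<Longrightarrow> U \<subseteq> U' \<Longrightarrow> U = U'"
    using finite_has_maximal by metis
  then have U: "U \<lhd> G" "openin T U" "W \<subseteq> U" "g \<notin> U" by (auto simp: F_def)
  interpret U: normal U G by (rule U(1))
  note sub = U.subgroup_axioms
  have gc: "g \<in> carrier G" using g E by blast
  have "h \<in> U \<union> (U #> g)" if h: "h \<in> E" for h
  proof (rule ccontr)
    assume n: "h \<notin> U \<union> (U #> g)"
    have hc: "h \<in> carrier G" using h E by blast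
    have hh: "h \<in> U #> h" using hc sub by (rule rcos_self)
    have nor: "U \<union> (U #> h) \<lhd> G"
      using normal_Un_coset[OF U(1) hc] square[OF h] comm[OF h] W(3) U(3) by blast
    have "g \<notin> U #> h"
      using n r_coset_eq_iff[OF sub hc gc] r_coset_eq_iff[OF sub gc hc] by blast
    moreover have "openin T (U \<union> (U #> h))"
      using U(2) openin_r_coset[OF U(2) U.subset hc] by (rule openin_Un)
    ultimately have "U \<union> (U #> h) \<in> F" using nor U by (auto simp: F_def)
    then show False using max n hh by blast
  qed
  then show thesis using that U by blast
qed

end

section \<open>Quadratic functions on finite groups with few squares and commutators\<close>

abbreviation (input) Z2 where "Z2 \<equiv> integer_mod_group 2"

lemma hom_Z2_iff: "\<kappa> \<in> hom Q Z2 \<longleftrightarrow>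
   (\<forall>x\<in>carrier Q. \<kappa> x \<in> {0, 1}) \<and>
   (\<forall>x\<in>carrier Q. \<forall>y\<in>carrier Q. \<kappa> (x \<otimes>\<^bsub>Q\<^esub> y) = (\<kappa> x + \<kappa> y) mod 2)"
proof -
  have "{0..<2} = {0, 1::int}" by auto
  then show ?thesis by (auto simp: hom_def carrier_integer_mod_group)
qed

lemma (in group) index_two_indicator_hom:
  assumes K: "subgroup K G"
    and two: "\<And>x y. x \<in> carrier G - K \<Longrightarrow> y \<in> carrier G - K \<Longrightarrow> x \<otimes> y \<in> K"
  shows "(\<lambda>x. if x \<in> K then 0 else 1) \<in> hom G Z2"
proof -
  interpret K: subgroup K G by (rule K)
  have "x \<otimes> y \<notin> K" if "x \<in> K" "y \<in> carrier G - K" for x y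
  proof
    assume "x \<otimes> y \<in> K"
    then have "inv x \<otimes> (x \<otimes> y) \<in> K" using that by simp
    then show False using that by (simp add: m_assoc[symmetric])
  qed
  moreover have "x \<otimes> y \<notin> K" if "x \<in> carrier G - K" "y \<in> K" for x y
  proof
    assume "x \<otimes> y \<in> K"
    then have "(x \<otimes> y) \<otimes> inv y \<in> K" using that by simp
    then show False using that by (simp add: m_assoc)
  qed
  ultimately show ?thesis using two by (auto simp: hom_Z2_iff)
qed

text \<open>
  The bilinear form \<open>\<Sum> \<psi>(x) \<psi>'(y)\<close>. A list of pairs of characters is used rather than a function, since the
  characters themselves are needed later to form an element of the tensor product.
\<close>

definition sum_of_products :: "(('a \<Rightarrow> int) \<times> ('a \<Rightarrow> int)) list \<Rightarrow> 'a \<Rightarrow> 'a \<Rightarrow> int" where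
  "sum_of_products ps x y = (\<Sum>(\<psi>, \<psi>') \<leftarrow> ps. \<psi> x * \<psi>' y)"

text \<open>
  If \<open>Q\<close> is finite, this says that it is a 2-group with Frattini subgroup contained in \<open>{1, z}\<close>; extraspecial
  2-groups are examples.
\<close>

locale squares_and_commutators_in_pair = group Q for Q (structure) +
  fixes z
  assumes z: "z \<in> carrier Q" "z \<noteq> \<one>"
    and square: "\<And>x. x \<in> carrier Q \<Longrightarrow> x \<otimes> x \<in> {\<one>, z}"
    and commutator: "\<And>x y. x \<in> carrier Q \<Longrightarrow> y \<in> carrier Q \<Longrightarrow> inv x \<otimes> inv y \<otimes> x \<otimes> y \<in> {\<one>, z}"
begin

lemma zz: "z \<otimes> z = \<one>"
  using square[OF z(1)] z by auto

lemma commute_up_to_z: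
  assumes "x \<in> carrier Q" "y \<in> carrier Q"
  shows "x \<otimes> y = y \<otimes> x \<or> x \<otimes> y = y \<otimes> x \<otimes> z"
proof -
  have "x \<otimes> y = y \<otimes> x \<otimes> (inv x \<otimes> inv y \<otimes> x \<otimes> y)"
    using assms by (simp add: m_assoc) (simp flip: m_assoc)
  moreover have "inv x \<otimes> inv y \<otimes> x \<otimes> y \<in> {\<one>, z}" using assms by (rule commutator)
  ultimately show ?thesis using assms by auto
qed

lemma z_central:
  assumes x: "x \<in> carrier Q"
  shows "x \<otimes> z = z \<otimes> x"
proof (rule ccontr)
  assume "x \<otimes> z \<noteq> z \<otimes> x"
  then have "x \<otimes> z = z \<otimes> (x \<otimes> z)" using commute_up_to_z[OF x z(1)] x z by (simp add: m_assoc)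
  then have "z = \<one>" using x z by simp
  then show False using z by simp
qed

lemma subgroup_insert_coset:
  assumes H: "subgroup H Q" "z \<in> H" and x: "x \<in> carrier Q"
  shows "subgroup (H \<union> (H #> x)) Q"
proof -
  interpret H: subgroup H Q by (rule H)
  have mem: "y \<in> H \<union> (H #> x) \<longleftrightarrow> y \<in> H \<or> (\<exists>h\<in>H. y = h \<otimes> x)" for y
    by (auto simp: r_coset_def)
  have square_H: "y \<otimes> y \<in> H" if "y \<in> carrier Q" for y
    using square[OF that] H by auto
  have swap: "\<exists>k\<in>H. x \<otimes> h = k \<otimes> x" if h: "h \<in> H" for h
  proof -
    have "x \<otimes> h = h \<otimes> x \<or> x \<otimes> h = (h \<otimes> z) \<otimes> x"
      using commute_up_to_z[OF x H.mem_carrier[OF h]] z_central[OF x] x z h H.mem_carrier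
      by (auto simp: m_assoc)
    then show ?thesis using h H(2) H.m_closed by blast
  qed
  show ?thesis
  proof (rule subgroupI)
    show "H \<union> (H #> x) \<subseteq> carrier Q" using H.subset x r_coset_subset_G by blast
    show "H \<union> (H #> x) \<noteq> {}" using H by blast
    fix a assume "a \<in> H \<union> (H #> x)"
    then have a: "a \<in> H \<or> (\<exists>h\<in>H. a = h \<otimes> x)" and ac: "a \<in> carrier Q" using mem x by auto
    show "inv a \<in> H \<union> (H #> x)"
    proof -
      have "inv a = inv (a \<otimes> a) \<otimes> a" using ac by (simp add: inv_mult_group m_assoc)
      moreover have "inv (a \<otimes> a) \<in> H" using square_H[OF ac] by simp
      ultimately show ?thesis using a mem H.m_closed x ac H.mem_carrier by (metis m_assoc)
    qed
    fix b assume "b \<in> H \<union> (H #> x)"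
    then have b: "b \<in> H \<or> (\<exists>h\<in>H. b = h \<otimes> x)" and bc: "b \<in> carrier Q" using mem x by auto
    show "a \<otimes> b \<in> H \<union> (H #> x)"
    proof (cases "a \<in> H")
      case True
      then show ?thesis using b mem H.m_closed x H.mem_carrier by (metis m_assoc)
    next
      case False
      then obtain h where h: "h \<in> H" "a = h \<otimes> x" using a by blast
      from b show ?thesis
      proof
        assume "b \<in> H"
        then obtain k where k: "k \<in> H" "x \<otimes> b = k \<otimes> x" using swap by blast
        then have "a \<otimes> b = (h \<otimes> k) \<otimes> x" using h bc x by (simp add: m_assoc)
        then show ?thesis using mem h k by blast
      next
        assume "\<exists>h\<in>H. b = h \<otimes> x"
        then obtain k where k: "k \<in> H" "b = k \<otimes> x" by blast
        then obtain k' where k': "k' \<in> H" "x \<otimes> k = k' \<otimes> x" using swap by blast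
        have "a \<otimes> b = h \<otimes> (x \<otimes> k) \<otimes> x" using h k x by (simp add: m_assoc)
        also have "\<dots> = (h \<otimes> k') \<otimes> (x \<otimes> x)" using h k' x by (simp add: m_assoc)
        finally show ?thesis using mem h(1) k'(1) square_H[OF x] H.m_closed by metis
      qed
    qed
  qed
qed

text \<open>
  Every subgroup above \<open>z\<close> contains all squares and commutators, so a maximal proper one has index 2.
\<close>

lemma separating_hom:
  assumes fin: "finite (carrier Q)" and H: "subgroup H Q" "z \<in> H" "H \<noteq> carrier Q"
  obtains \<kappa> x where "\<kappa> \<in> hom Q Z2" "\<forall>h\<in>H. \<kappa> h = 0" "x \<in> carrier Q" "\<kappa> x = 1"
proof -
  define F where "F = {K. subgroup K Q \<and> H \<subseteq> K \<and> K \<noteq> carrier Q}"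
  have "F \<subseteq> Pow (carrier Q)" using subgroup.subset by (auto simp: F_def)
  then have "finite F" using fin by (simp add: finite_subset)
  moreover have "F \<noteq> {}" using H by (auto simp: F_def)
  ultimately obtain K where "K \<in> F" and max: "\<And>K'. K' \<in> F \<Longrightarrow> K \<subseteq> K' \<Longrightarrow> K = K'"
    using finite_has_maximal by metis
  then have K: "subgroup K Q" "H \<subseteq> K" "K \<noteq> carrier Q" by (auto simp: F_def)
  interpret K: subgroup K Q by (rule K)
  have "x \<otimes> y \<in> K" if x: "x \<in> carrier Q - K" and y: "y \<in> carrier Q - K" for x y
  proof -
    have "y \<in> K \<union> (K #> y)" using rcos_self K(1) y by blast
    then have "K \<union> (K #> y) \<notin> F" using max y by blast
    then have "K \<union> (K #> y) = carrier Q"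
      using subgroup_insert_coset[of K y] K H y by (auto simp: F_def)
    then obtain k where k: "k \<in> K" "x = k \<otimes> y" using x by (auto simp: r_coset_def)
    then have "x \<otimes> y = k \<otimes> (y \<otimes> y)" using y by (simp add: m_assoc)
    moreover have "y \<otimes> y \<in> K" using square[of y] y H K by auto
    ultimately show ?thesis using k by simp
  qed
  then have "(\<lambda>x. if x \<in> K then 0 else 1) \<in> hom Q Z2"
    by (rule index_two_indicator_hom[OF K(1)])
  moreover obtain x where "x \<in> carrier Q" "x \<notin> K" using K.subset K(3) by blast
  moreover have "\<forall>h\<in>H. (if h \<in> K then 0 else 1) = (0::int)" using K(2) by auto
  ultimately show thesis by (intro that[of "\<lambda>x. if x \<in> K then 0 else 1" x]) auto
qed

text \<open>
  On \<open>H\<close> the coboundary of \<open>f\<close> modulo 2 is the bilinear form of \<open>ps\<close>. The characters are defined on all of \<open>Q\<close>, also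
  when \<open>H\<close> is smaller, so that they need not be extended along with \<open>H\<close>. The condition
  \<open>\<psi>' z = 0\<close> makes \<open>f\<close> change by 1 under multiplication with \<open>z\<close>. As \<open>z\<close> need not be a square or a
  commutator, it does not hold automatically.
\<close>

definition quadratic_on :: "'a set \<Rightarrow> ('a \<Rightarrow> int) \<Rightarrow> (('a \<Rightarrow> int) \<times> ('a \<Rightarrow> int)) list \<Rightarrow> bool" where
  "quadratic_on H f ps \<longleftrightarrow>
     (\<forall>(\<psi>, \<psi>') \<in> set ps. \<psi> \<in> hom Q Z2 \<and> \<psi>' \<in> hom Q Z2 \<and> \<psi>' z = 0) \<and> f z = 1 \<and>
     (\<forall>x\<in>H. \<forall>y\<in>H. even (f (x \<otimes> y) + f x + f y + sum_of_products ps x y))"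

text \<open>
  Commuting with \<open>x\<close> is a linear condition because the commutators with \<open>x\<close> are central of order at most 2.
\<close>

lemma commutator_hom:
  assumes x: "x \<in> carrier Q"
  shows "(\<lambda>k. if x \<otimes> k = k \<otimes> x then 0 else 1) \<in> hom Q Z2"
proof -
  have c: "subgroup {k \<in> carrier Q. x \<otimes> k = k \<otimes> x} Q" (is "subgroup ?C Q")
  proof (rule subgroupI)
    show "?C \<noteq> {}" using x by (auto intro!: exI[of _ \<one>])
    show "inv a \<in> ?C" if "a \<in> ?C" for a
      using that x by (simp add: inv_solve_left' inv_solve_right m_assoc) (metis inv_solve_left' inv_solve_right m_assoc m_closed inv_closed)
    show "a \<otimes> b \<in> ?C" if "a \<in> ?C" "b \<in> ?C" for a b
      using that x by (simp flip: m_assoc) (simp add: m_assoc)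
  qed auto
  have "h \<otimes> k \<in> ?C" if "h \<in> carrier Q - ?C" "k \<in> carrier Q - ?C" for h k
  proof -
    have h: "x \<otimes> h = h \<otimes> x \<otimes> z" and k: "x \<otimes> k = k \<otimes> x \<otimes> z"
      using that commute_up_to_z x by auto
    have "x \<otimes> (h \<otimes> k) = h \<otimes> x \<otimes> (z \<otimes> k)" using h x that z by (simp flip: m_assoc)
    also have "\<dots> = h \<otimes> (x \<otimes> k) \<otimes> z" using z_central[of k] x that z by (simp add: m_assoc)
    also have "\<dots> = h \<otimes> k \<otimes> x" using k x that z zz by (simp add: m_assoc)
    finally show ?thesis using that by simp
  qed
  from index_two_indicator_hom[OF c this] have "(\<lambda>k. if k \<in> ?C then 0 else 1) \<in> hom Q Z2" .
  moreover have "(\<lambda>k. if k \<in> ?C then 0 else 1) k = (if x \<otimes> k = k \<otimes> x then 0 else 1 :: int)" if "k \<in> carrier Q" for k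
    using that by simp
  ultimately show ?thesis unfolding hom_Z2_iff by (simp del: insert_iff) 
qed

lemma sum_of_products_z:
  assumes "quadratic_on H f ps"
  shows "sum_of_products ps y z = 0"
proof -
  have "\<forall>p\<in>set ps. snd p z = 0" using assms by (auto simp: quadratic_on_def)
  then show ?thesis unfolding sum_of_products_def by (induction ps) auto
qed

lemma quadratic_mult_z:
  assumes q: "quadratic_on H f ps" and H: "subgroup H Q" "z \<in> H" and a: "a \<in> H" and c: "c \<in> {\<one>, z}"
  shows "even (f (a \<otimes> c) + f a + (if c = z then 1 else 0))"
proof (cases "c = z")
  case True
  have "even (f (a \<otimes> z) + f a + f z + sum_of_products ps a z)" "f z = 1"
    using q a H unfolding quadratic_on_def by blast+
  then show ?thesis using sum_of_products_z[OF q] True by simp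
next
  case False
  then have "c = \<one>" using c by simp
  then show ?thesis using False a subgroup.mem_carrier[OF H(1)] by simp
qed

text \<open>
  One more coset \<open>H x\<close> is added by \<open>f (h x) = f h\<close>. Moving \<open>x\<close> past an element \<open>k\<close> of \<open>H\<close> costs the commutator
  \<open>\<mu> k\<close>, and a product of two elements of \<open>H x\<close> produces the square of \<open>x\<close>. With \<open>\<kappa>\<close> the
  character that tells \<open>H x\<close> from \<open>H\<close>, the form therefore grows by \<open>\<kappa>(y) \<mu>(w)\<close> and, if \<open>x\<close> has
  square \<open>z\<close>, by \<open>\<kappa>(y) \<kappa>(w)\<close>.
\<close>

lemma quadratic_extend:
  assumes fin: "finite (carrier Q)" and H: "subgroup H Q" "z \<in> H" "H \<noteq> carrier Q"
    and q: "quadratic_on H f ps"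
  obtains H' f' ps' where "subgroup H' Q" "H \<subset> H'" "quadratic_on H' f' ps'"
proof -
  interpret H: subgroup H Q by (rule H)
  obtain \<kappa> x where \<kappa>: "\<kappa> \<in> hom Q Z2" "\<forall>h\<in>H. \<kappa> h = 0" and x: "x \<in> carrier Q" "\<kappa> x = 1"
    using separating_hom[OF fin H] .
  have xH: "x \<notin> H" using \<kappa> x by auto
  define \<mu> :: "'a \<Rightarrow> int" where "\<mu> = (\<lambda>k. if x \<otimes> k = k \<otimes> x then 0 else 1)"
  have \<mu>: "\<mu> \<in> hom Q Z2" unfolding \<mu>_def using x(1) by (rule commutator_hom)
  \<comment> \<open>Adding a multiple of \<open>\<kappa>\<close> makes a character trivial at \<open>x\<close> without changing it on \<open>H\<close>, so
  that the old form only sees the \<open>H\<close>-part \<open>pr y\<close> of \<open>y\<close>.\<close>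
  define adj where "adj = (\<lambda>(\<psi>::'a \<Rightarrow> int) y. (\<psi> y + \<psi> x * \<kappa> y) mod 2)"
  define H' where "H' = H \<union> (H #> x)"
  define pr where "pr = (\<lambda>y. if y \<in> H then y else y \<otimes> inv x)"
  define f' where "f' = (\<lambda>y. f (pr y))"
  define ps' where "ps' = map (\<lambda>(\<psi>, \<psi>'). (adj \<psi>, adj \<psi>')) ps @ (\<kappa>, \<mu>) # (if x \<otimes> x = z then [(\<kappa>, \<kappa>)] else [])"
  have H': "subgroup H' Q" unfolding H'_def by (rule subgroup_insert_coset[OF H(1,2) x(1)])
  have not_H: "h \<otimes> x \<notin> H" if "h \<in> H" for h
  proof
    assume "h \<otimes> x \<in> H"
    then have "inv h \<otimes> (h \<otimes> x) \<in> H" using that by simp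
    then show False using that x xH by (simp flip: m_assoc)
  qed
  have pr_H: "pr h = h" "\<kappa> h = 0" if "h \<in> H" for h
    using that \<kappa> by (auto simp: pr_def)
  have pr_x: "pr (h \<otimes> x) = h" "\<kappa> (h \<otimes> x) = 1" if "h \<in> H" for h
    using that not_H[OF that] x \<kappa> by (auto simp: pr_def m_assoc hom_Z2_iff)
  have cases: "(y \<in> H) \<or> (\<exists>h\<in>H. y = h \<otimes> x)" if "y \<in> H'" for y
    using that by (auto simp: H'_def r_coset_def)
  have adj_hom: "adj \<psi> \<in> hom Q Z2" if "\<psi> \<in> hom Q Z2" for \<psi>
    unfolding hom_Z2_iff
  proof (intro conjI ballI)
    fix y w assume "y \<in> carrier Q" "w \<in> carrier Q"
    then have "\<psi> (y \<otimes> w) = (\<psi> y + \<psi> w) mod 2" "\<kappa> (y \<otimes> w) = (\<kappa> y + \<kappa> w) mod 2" "\<psi> x \<in> {0, 1}"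
      using that \<kappa>(1) x(1) unfolding hom_Z2_iff by blast+
    then show "adj \<psi> (y \<otimes> w) = (adj \<psi> y + adj \<psi> w) mod 2"
      unfolding adj_def by (elim insertE emptyE; simp; presburger)
  qed (auto simp: adj_def)
  have adj_pr: "adj \<psi> y = \<psi> (pr y)" if y: "y \<in> H'" and \<psi>: "\<psi> \<in> hom Q Z2" for \<psi> y
    using cases[OF y]
  proof
    assume yH: "y \<in> H"
    then have "\<psi> y \<in> {0, 1}" using \<psi> H.mem_carrier unfolding hom_Z2_iff by blast
    then show ?thesis using pr_H[OF yH] by (auto simp: adj_def)
  next
    assume "\<exists>h\<in>H. y = h \<otimes> x"
    then obtain h where h: "h \<in> H" "y = h \<otimes> x" by blast
    then have "\<psi> y = (\<psi> h + \<psi> x) mod 2" "\<psi> h \<in> {0, 1}" "\<psi> x \<in> {0, 1}"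
      using \<psi> x(1) H.mem_carrier unfolding hom_Z2_iff by blast+
    then show ?thesis using pr_x[OF h(1)] h(2) by (auto simp: adj_def)
  qed
  have bil: "sum_of_products ps' y w = sum_of_products ps (pr y) (pr w) + \<kappa> y * \<mu> w + (if x \<otimes> x = z then \<kappa> y * \<kappa> w else 0)"
    if yw: "y \<in> H'" "w \<in> H'" for y w
  proof -
    have "\<forall>p\<in>set ps. fst p \<in> hom Q Z2 \<and> snd p \<in> hom Q Z2" using q by (auto simp: quadratic_on_def)
    then have "sum_of_products (map (\<lambda>(\<psi>, \<psi>'). (adj \<psi>, adj \<psi>')) ps) y w = sum_of_products ps (pr y) (pr w)"
      unfolding sum_of_products_def by (induction ps) (auto simp: adj_pr yw)
    then show ?thesis by (simp add: ps'_def sum_of_products_def)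
  qed
  have main: "even (f' (y \<otimes> w) + f' y + f' w + sum_of_products ps' y w)" if yw: "y \<in> H'" "w \<in> H'" for y w
  proof -
    define h where "h = pr y"
    define k where "k = pr w"
    have hk: "h \<in> H" "k \<in> H"
      unfolding h_def k_def using cases[OF yw(1)] cases[OF yw(2)] pr_H(1) pr_x(1) by metis+
    note [simp] = H.mem_carrier[OF hk(1)] H.mem_carrier[OF hk(2)] x(1) z(1)
    have hkH: "h \<otimes> k \<in> H" using hk by simp
    have base: "even (f (h \<otimes> k) + f h + f k + sum_of_products ps h k)" using q hk by (auto simp: quadratic_on_def)
    define c where "c = (if x \<otimes> k = k \<otimes> x then \<one> else z)"
    have c: "c \<in> {\<one>, z}" "c \<in> H" "x \<otimes> k = k \<otimes> x \<otimes> c" "\<mu> k = (if c = z then 1 else 0)"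
      using commute_up_to_z[of x k] H(2) z by (auto simp: c_def \<mu>_def)
    have cc: "c \<in> carrier Q" and xc: "x \<otimes> c = c \<otimes> x" using c z_central[of x] by auto
    have xk: "x \<otimes> k = k \<otimes> c \<otimes> x" using c(3) xc cc by (simp add: m_assoc)
    have hkc: "even (f (h \<otimes> k \<otimes> c) + f (h \<otimes> k) + \<mu> k)"
      using quadratic_mult_z[OF q H(1,2) _ c(1), of "h \<otimes> k"] hk c(4) by simp
    have y: "y \<in> H \<and> y = h \<and> \<kappa> y = 0 \<or> y = h \<otimes> x \<and> \<kappa> y = 1"
      unfolding h_def using cases[OF yw(1)] pr_H pr_x by metis
    have w: "w \<in> H \<and> w = k \<and> \<kappa> w = 0 \<or> w = k \<otimes> x \<and> \<kappa> w = 1"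
      unfolding k_def using cases[OF yw(2)] pr_H pr_x by metis
    have \<mu>w: "\<mu> w = \<mu> k"
    proof -
      have "\<mu> (k \<otimes> x) = (\<mu> k + \<mu> x) mod 2" "\<mu> x = 0" "\<mu> k \<in> {0, 1}"
        using \<mu> by (auto simp: hom_Z2_iff \<mu>_def)
      then show ?thesis using w by auto
    qed
    note B = bil[OF yw, folded h_def k_def, unfolded \<mu>w]
    have f': "f' y = f h" "f' w = f k" by (simp_all add: f'_def h_def k_def)
    consider (00) "y = h" "w = k" "\<kappa> y = 0" | (01) "y = h" "w = k \<otimes> x" "\<kappa> y = 0"
      | (10) "y = h \<otimes> x" "w = k" "\<kappa> y = 1" "\<kappa> w = 0"
      | (11) "y = h \<otimes> x" "w = k \<otimes> x" "\<kappa> y = 1" "\<kappa> w = 1"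
      using y w by blast
    then show ?thesis
    proof cases
      case 00
      then have "f' (y \<otimes> w) = f (h \<otimes> k)" using pr_H(1)[of "h \<otimes> k"] hk by (simp add: f'_def)
      then show ?thesis using B f' base 00 by simp
    next
      case 01
      then have "y \<otimes> w = (h \<otimes> k) \<otimes> x" by (simp add: m_assoc)
      then have "f' (y \<otimes> w) = f (h \<otimes> k)" using pr_x[of "h \<otimes> k"] hk by (simp add: f'_def)
      then show ?thesis using B f' base 01 by simp
    next
      case 10
      then have "y \<otimes> w = (h \<otimes> k \<otimes> c) \<otimes> x" using xk cc by (simp add: m_assoc)
      then have "f' (y \<otimes> w) = f (h \<otimes> k \<otimes> c)" using pr_x[of "h \<otimes> k \<otimes> c"] hk c(2) by (simp add: f'_def)
      then show ?thesis using B f' base hkc 10 by (simp, argo)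
    next
      case 11
      then have "y \<otimes> w = h \<otimes> (x \<otimes> k) \<otimes> x" by (simp add: m_assoc)
      also have "\<dots> = (h \<otimes> k \<otimes> c) \<otimes> (x \<otimes> x)" using cc by (simp add: xk m_assoc)
      finally have yw': "y \<otimes> w = (h \<otimes> k \<otimes> c) \<otimes> (x \<otimes> x)" .
      have xx: "x \<otimes> x \<in> {\<one>, z}" by (rule square) simp
      then have "y \<otimes> w \<in> H" using yw' hk c(2) H(2) by auto
      then have "f' (y \<otimes> w) = f ((h \<otimes> k \<otimes> c) \<otimes> (x \<otimes> x))" using pr_H(1)[of "y \<otimes> w"] yw' by (simp add: f'_def)
      moreover have "even (f ((h \<otimes> k \<otimes> c) \<otimes> (x \<otimes> x)) + f (h \<otimes> k \<otimes> c) + (if x \<otimes> x = z then 1 else 0))"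
        using quadratic_mult_z[OF q H(1,2) _ xx, of "h \<otimes> k \<otimes> c"] hk c(2) by simp
      ultimately show ?thesis using B f' base hkc 11 by (cases "x \<otimes> x = z") (simp, argo)+
    qed
  qed
  have "quadratic_on H' f' ps'"
    unfolding quadratic_on_def
  proof (intro conjI)
    have "\<psi> \<in> hom Q Z2 \<and> \<psi>' \<in> hom Q Z2 \<and> \<psi>' z = 0" if "(\<psi>, \<psi>') \<in> set ps'" for \<psi> \<psi>'
    proof -
      have "adj \<phi> z = 0" if "\<phi> z = 0" for \<phi> using that \<kappa> H(2) by (simp add: adj_def)
      moreover have "\<mu> z = 0" using z_central[OF x(1)] by (simp add: \<mu>_def)
      moreover have "\<kappa> z = 0" using \<kappa> H by blast
      ultimately show ?thesis
        using that q adj_hom \<kappa>(1) \<mu> by (auto simp: ps'_def quadratic_on_def split: if_splits)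
    qed
    then show "\<forall>(\<psi>, \<psi>')\<in>set ps'. \<psi> \<in> hom Q Z2 \<and> \<psi>' \<in> hom Q Z2 \<and> \<psi>' z = 0" by blast
    show "f' z = 1" using q pr_H(1)[OF H(2)] by (simp add: f'_def quadratic_on_def)
    show "\<forall>x\<in>H'. \<forall>y\<in>H'. even (f' (x \<otimes> y) + f' x + f' y + sum_of_products ps' x y)" using main by blast
  qed
  moreover have "H \<subset> H'" using rcos_self[OF x(1) H(1)] xH by (auto simp: H'_def)
  ultimately show thesis using that H' by blast
qed

text \<open>
  The extension starts from the subgroup generated by \<open>z\<close> with the empty form and \<open>f\<close> the nontrivial character.
\<close>

lemma quadratic_on_carrier:
  assumes fin: "finite (carrier Q)"
  obtains f ps where "quadratic_on (carrier Q) f ps"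
proof -
  have "\<exists>f ps. quadratic_on (carrier Q) f ps" if "subgroup H Q" "z \<in> H" "quadratic_on H f ps" for H f ps
    using that
  proof (induction "card (carrier Q - H)" arbitrary: H f ps rule: less_induct)
    case less
    show ?case
    proof (cases "H = carrier Q")
      case False
      obtain H' f' ps' where H': "subgroup H' Q" "H \<subset> H'" "quadratic_on H' f' ps'"
        using quadratic_extend[OF fin less.prems(1,2) False less.prems(3)] .
      have "carrier Q - H' \<subset> carrier Q - H" using H'(2) subgroup.subset[OF H'(1)] by blast
      then have "card (carrier Q - H') < card (carrier Q - H)" using fin by (simp add: psubset_card_mono)
      then show ?thesis using less.hyps H' less.prems(2) by blast
    qed (use less.prems in blast)
  qed
  moreover have "subgroup {\<one>, z} Q"
    using z zz inv_equality[of z z] by (intro subgroupI) auto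
  moreover have "quadratic_on {\<one>, z} (\<lambda>y. if y = z then 1 else 0) []"
    using z zz by (auto simp: quadratic_on_def sum_of_products_def)
  ultimately show thesis using that by blast
qed

end

section \<open>Continuous cochains modulo 2\<close>

text \<open>
  This identifies any homomorphism known on generators with the product formula by which maps
  on the tensor product are defined.
\<close>

lemma hom_free_Abelian_group_finprod:
  assumes H: "comm_group H" and h: "h \<in> hom (free_Abelian_group S) H" and t: "Poly_Mapping.keys t \<subseteq> S"
  shows "h t = finprod H (\<lambda>a. h (frag_of a) [^]\<^bsub>H\<^esub> Poly_Mapping.lookup t a) (Poly_Mapping.keys t)"
proof -
  interpret H: comm_group H by (rule H)
  interpret h: group_hom "free_Abelian_group S" H h
    using h by (intro group_hom.intro group_hom_axioms.intro) auto
  have h_of: "h (frag_of a) \<in> carrier H" if "a \<in> S" for a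
    using that h.hom_closed[of "frag_of a"] by (simp add: keys_frag_of)
  have "Poly_Mapping.keys (\<Sum>a\<in>A. frag_cmul (n a) (frag_of a)) \<subseteq> S \<and>
      h (\<Sum>a\<in>A. frag_cmul (n a) (frag_of a)) = finprod H (\<lambda>a. h (frag_of a) [^]\<^bsub>H\<^esub> (n a :: int)) A"
    if "finite A" "A \<subseteq> S" for A n
    using that
  proof (induction A rule: finite_induct)
    case empty
    then show ?case using h.hom_one by simp
  next
    case (insert a A)
    let ?s = "\<Sum>a\<in>A. frag_cmul (n a) (frag_of a)"
    have s: "Poly_Mapping.keys ?s \<subseteq> S" "Poly_Mapping.keys (frag_cmul (n a) (frag_of a)) \<subseteq> S"
      using insert keys_cmul[of "n a" "frag_of a"] by (auto simp: keys_frag_of)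
    then have "Poly_Mapping.keys (frag_cmul (n a) (frag_of a) + ?s) \<subseteq> S"
      using keys_add[of "frag_cmul (n a) (frag_of a)" ?s] by blast
    moreover have "h (frag_cmul (n a) (frag_of a) + ?s) = h (frag_cmul (n a) (frag_of a)) \<otimes>\<^bsub>H\<^esub> h ?s"
      using h.hom_mult[of "frag_cmul (n a) (frag_of a)" ?s] s by simp
    moreover have "h (frag_cmul (n a) (frag_of a)) = h (frag_of a) [^]\<^bsub>H\<^esub> n a"
      using h.hom_int_pow[of "frag_of a" "n a"] insert by (simp add: keys_frag_of)
    moreover have "finprod H (\<lambda>a. h (frag_of a) [^]\<^bsub>H\<^esub> n a) (insert a A)
      = h (frag_of a) [^]\<^bsub>H\<^esub> n a \<otimes>\<^bsub>H\<^esub> finprod H (\<lambda>a. h (frag_of a) [^]\<^bsub>H\<^esub> n a) A"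
      using insert h_of by (intro H.finprod_insert) auto
    ultimately show ?case using insert by simp
  qed
  from this[OF _ t, of "Poly_Mapping.lookup t"] show ?thesis
    using frag_expansion[of t] by (simp add: frag_extend_def)
qed

lemma continuous_map_discrete_comp:
  assumes "continuous_map Y (discrete_topology A) f" "\<And>a. a \<in> A \<Longrightarrow> k a \<in> C"
  shows "continuous_map Y (discrete_topology C) (\<lambda>x. k (f x))"
  using continuous_map_compose[OF assms(1), of "discrete_topology C" k] assms(2) by (simp add: o_def)

lemma continuous_map_discrete_comp2:
  assumes "continuous_map Y (discrete_topology A) f" "continuous_map Y (discrete_topology B) g"
    and "\<And>a b. a \<in> A \<Longrightarrow> b \<in> B \<Longrightarrow> k a b \<in> C"
  shows "continuous_map Y (discrete_topology C) (\<lambda>x. k (f x) (g x))"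
proof -
  have "continuous_map Y (discrete_topology (A \<times> B)) (\<lambda>x. (f x, g x))"
    using assms by (simp add: prod_topology_discrete_topology continuous_map_pairedI)
  from continuous_map_discrete_comp[OF this, of "\<lambda>(a, b). k a b"] show ?thesis
    using assms(3) by auto
qed

lemma carrier_continuous_functions:
  "f \<in> carrier (continuous_functions Y A) \<longleftrightarrow>
     f \<in> extensional (topspace Y) \<and> continuous_map Y (discrete_topology (carrier A)) f"
  by (simp add: continuous_functions_def)

lemma continuous_functions_apply_closed:
  "f \<in> carrier (continuous_functions Y A) \<Longrightarrow> x \<in> topspace Y \<Longrightarrow> f x \<in> carrier A"
  by (auto simp: carrier_continuous_functions continuous_map_def)

lemma mult_continuous_functions [simp]:
  "f \<otimes>\<^bsub>continuous_functions Y A\<^esub> f' = (\<lambda>x\<in>topspace Y. f x \<otimes>\<^bsub>A\<^esub> f' x)"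
  by (simp add: continuous_functions_def)

lemma one_continuous_functions [simp]:
  "\<one>\<^bsub>continuous_functions Y A\<^esub> = (\<lambda>x\<in>topspace Y. \<one>\<^bsub>A\<^esub>)"
  by (simp add: continuous_functions_def)

lemma continuous_functions_restrictI:
  assumes "continuous_map Y (discrete_topology (carrier A)) f"
  shows "restrict f (topspace Y) \<in> carrier (continuous_functions Y A)"
proof -
  have "continuous_map Y (discrete_topology (carrier A)) (restrict f (topspace Y))"
    by (rule continuous_map_eq[OF assms]) simp
  then show ?thesis by (simp add: carrier_continuous_functions)
qed

lemma comm_group_continuous_functions:
  assumes "comm_group A"
  shows "comm_group (continuous_functions Y A)"
proof -
  interpret A: comm_group A by (rule assms)
  note ext = extensionalityI[where A = "topspace Y"]
  note cl = continuous_functions_apply_closed[where A = A and Y = Y]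
  show ?thesis
  proof (rule comm_groupI)
    fix f g assume fg: "f \<in> carrier (continuous_functions Y A)" "g \<in> carrier (continuous_functions Y A)"
    then show "f \<otimes>\<^bsub>continuous_functions Y A\<^esub> g \<in> carrier (continuous_functions Y A)"
      unfolding mult_continuous_functions
      by (intro continuous_functions_restrictI continuous_map_discrete_comp2[where k = "\<lambda>a b. a \<otimes>\<^bsub>A\<^esub> b"])
         (auto simp: carrier_continuous_functions)
    show "f \<otimes>\<^bsub>continuous_functions Y A\<^esub> g = g \<otimes>\<^bsub>continuous_functions Y A\<^esub> f"
      by (rule ext) (use cl fg in \<open>auto simp: A.m_comm\<close>)
  next
    show "\<one>\<^bsub>continuous_functions Y A\<^esub> \<in> carrier (continuous_functions Y A)"
      by (simp add: continuous_functions_restrictI)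
  next
    fix f g h assume fgh: "f \<in> carrier (continuous_functions Y A)" "g \<in> carrier (continuous_functions Y A)"
      "h \<in> carrier (continuous_functions Y A)"
    show "f \<otimes>\<^bsub>continuous_functions Y A\<^esub> g \<otimes>\<^bsub>continuous_functions Y A\<^esub> h =
      f \<otimes>\<^bsub>continuous_functions Y A\<^esub> (g \<otimes>\<^bsub>continuous_functions Y A\<^esub> h)"
      by (rule ext) (use cl fgh in \<open>auto simp: A.m_assoc\<close>)
  next
    fix f assume f: "f \<in> carrier (continuous_functions Y A)"
    show "\<one>\<^bsub>continuous_functions Y A\<^esub> \<otimes>\<^bsub>continuous_functions Y A\<^esub> f = f"
      by (rule ext) (use cl f in \<open>auto simp: carrier_continuous_functions\<close>)
    let ?g = "\<lambda>x\<in>topspace Y. inv\<^bsub>A\<^esub> f x"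
    have "?g \<in> carrier (continuous_functions Y A)"
      using f by (intro continuous_functions_restrictI continuous_map_discrete_comp[where k = "m_inv A"])
        (auto simp: carrier_continuous_functions)
    moreover have "?g \<otimes>\<^bsub>continuous_functions Y A\<^esub> f = \<one>\<^bsub>continuous_functions Y A\<^esub>"
      by (rule ext) (use cl f in auto)
    ultimately show "\<exists>g\<in>carrier (continuous_functions Y A).
        g \<otimes>\<^bsub>continuous_functions Y A\<^esub> f = \<one>\<^bsub>continuous_functions Y A\<^esub>" by blast
  qed
qed

lemma carrier_Z2: "carrier Z2 = {0, 1}"
  by (auto simp: carrier_integer_mod_group)

lemma mod2_carrier_Z2 [simp]: "(a::int) mod 2 \<in> carrier Z2"
  by (auto simp: carrier_Z2)

lemma add_mod2_interchange:
  fixes a :: int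
  shows "((a + a') mod 2 + (b + b') mod 2 + (c + c') mod 2) mod 2 =
      ((a + b + c) mod 2 + (a' + b' + c') mod 2) mod 2" (is "?L mod 2 = ?R mod 2")
    and "((a + a') mod 2 + (b + b') mod 2 + (c + c') mod 2 + (d + d') mod 2) mod 2 =
      ((a + b + c + d) mod 2 + (a' + b' + c' + d') mod 2) mod 2" (is "?M mod 2 = ?S mod 2")
proof -
  have "even (?L - ?R) \<longleftrightarrow> even (((a + a') + (b + b') + (c + c')) - ((a + b + c) + (a' + b' + c')))"
    by (simp only: even_diff even_add even_mod_2_iff)
  then show "?L mod 2 = ?R mod 2" by (simp add: mod_eq_dvd_iff del: even_diff even_add)
  have "even (?M - ?S) \<longleftrightarrow>
      even (((a + a') + (b + b') + (c + c') + (d + d')) - ((a + b + c + d) + (a' + b' + c' + d')))"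
    by (simp only: even_diff even_add even_mod_2_iff)
  then show "?M mod 2 = ?S mod 2" by (simp add: mod_eq_dvd_iff del: even_diff even_add)
qed

text \<open>
  The cancellation behind the vanishing of the composite of two coboundary maps. Here \<open>ab\<close>, \<open>bc\<close>, \<open>abc\<close> stand for
  the values of a cochain at products of the arguments that give \<open>a\<close>, \<open>b\<close>, \<open>c\<close>.
\<close>

lemma even_coboundary_of_coboundary:
  fixes a :: int
  shows "even ((b + c + bc) mod 2 + (ab + c + abc) mod 2 + (a + bc + abc) mod 2 + (a + b + ab) mod 2)"
proof -
  have "even ((b + c + bc) mod 2 + (ab + c + abc) mod 2 + (a + bc + abc) mod 2 + (a + b + ab) mod 2) \<longleftrightarrow>
      even ((b + c + bc) + (ab + c + abc) + (a + bc + abc) + (a + b + ab))"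
    by (simp only: even_add even_mod_2_iff)
  also have "(b + c + bc) + (ab + c + abc) + (a + bc + abc) + (a + b + ab) = 2 * (a + b + c + ab + bc + abc)"
    by simp
  finally show ?thesis by simp
qed

context profinite_group
begin

abbreviation "C1 \<equiv> cochains1 T Z2"
abbreviation "C2 \<equiv> cochains2 T Z2"
abbreviation "C3 \<equiv> cochains3 T Z2"
abbreviation "\<delta>1 \<equiv> coboundary1 G Z2"
abbreviation "\<delta>2 \<equiv> coboundary2 G Z2"
abbreviation "HH1 \<equiv> H1 G T Z2"
abbreviation "HH2 \<equiv> H2 G T Z2"
abbreviation "ZZ2 \<equiv> cocycles2 G T Z2"
abbreviation "BB2 \<equiv> coboundaries2 G T Z2"

lemma topspace_prod: "topspace (prod_topology T T) = carrier G \<times> carrier G"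
  "topspace (prod_topology T (prod_topology T T)) = carrier G \<times> carrier G \<times> carrier G"
  by (simp_all add: topspace_eq)

lemma C1_values: "f \<in> carrier C1 \<Longrightarrow> x \<in> carrier G \<Longrightarrow> f x \<in> carrier Z2"
  using continuous_functions_apply_closed by (metis topspace_eq)

lemma C2_values: "c \<in> carrier C2 \<Longrightarrow> x \<in> carrier G \<Longrightarrow> y \<in> carrier G \<Longrightarrow> c (x, y) \<in> carrier Z2"
  using continuous_functions_apply_closed[of c "prod_topology T T" Z2 "(x, y)"] by (simp add: topspace_eq)

lemma coboundary1_extensional: "\<delta>1 f \<in> extensional (carrier G \<times> carrier G)"
  by (simp add: coboundary1_def)

lemma coboundary2_extensional: "\<delta>2 f \<in> extensional (carrier G \<times> carrier G \<times> carrier G)"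
  by (simp add: coboundary2_def)

lemma coboundary1_apply:
  assumes "f \<in> carrier C1" "x \<in> carrier G" "y \<in> carrier G"
  shows "\<delta>1 f (x, y) = (f x + f y + f (x \<otimes> y)) mod 2"
proof -
  have "f x \<in> carrier Z2" "f y \<in> carrier Z2" "f (x \<otimes> y) \<in> carrier Z2"
    using assms C1_values by auto
  then show ?thesis using assms by (auto simp: coboundary1_def carrier_Z2)
qed

lemma coboundary2_apply:
  assumes "c \<in> carrier C2" "x \<in> carrier G" "y \<in> carrier G" "w \<in> carrier G"
  shows "\<delta>2 c (x, y, w) = (c (y, w) + c (x \<otimes> y, w) + c (x, y \<otimes> w) + c (x, y)) mod 2"
proof -
  have "c (y, w) \<in> carrier Z2" "c (x \<otimes> y, w) \<in> carrier Z2" "c (x, y \<otimes> w) \<in> carrier Z2" "c (x, y) \<in> carrier Z2"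
    using assms C2_values by auto
  then show ?thesis using assms by (auto simp: coboundary2_def carrier_Z2)
qed

lemma coboundary1_closed:
  assumes f: "f \<in> carrier C1"
  shows "\<delta>1 f \<in> carrier C2"
proof -
  have fc: "continuous_map T (discrete_topology (carrier Z2)) f"
    using f by (simp add: carrier_continuous_functions)
  let ?P = "prod_topology T T"
  have m: "continuous_map ?P T (\<lambda>p. fst p \<otimes> snd p)"
    by (intro continuous_map_mult continuous_map_fst continuous_map_snd)
  have "continuous_map ?P (discrete_topology (carrier Z2)) (\<lambda>p. f (fst p))"
    "continuous_map ?P (discrete_topology (carrier Z2)) (\<lambda>p. f (snd p))"
    "continuous_map ?P (discrete_topology (carrier Z2)) (\<lambda>p. f (fst p \<otimes> snd p))"
    using continuous_map_compose[OF continuous_map_fst fc] continuous_map_compose[OF continuous_map_snd fc]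
      continuous_map_compose[OF m fc] by (simp_all add: o_def)
  then have "continuous_map ?P (discrete_topology (carrier Z2)) (\<lambda>p. ((f (fst p) + f (snd p)) mod 2 + f (fst p \<otimes> snd p)) mod 2)"
    by (intro continuous_map_discrete_comp2[where k = "\<lambda>a b. (a + b) mod 2"]) auto
  from continuous_functions_restrictI[OF this]
  have "(\<lambda>p\<in>carrier G \<times> carrier G. (f (fst p) + f (snd p) + f (fst p \<otimes> snd p)) mod 2) \<in> carrier C2"
    by (simp add: topspace_eq mod_simps)
  moreover have "\<delta>1 f = (\<lambda>p\<in>carrier G \<times> carrier G. (f (fst p) + f (snd p) + f (fst p \<otimes> snd p)) mod 2)"
    using f by (auto simp: fun_eq_iff coboundary1_apply) (auto simp: coboundary1_def)
  ultimately show ?thesis by simp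
qed

lemma coboundary2_closed:
  assumes c: "c \<in> carrier C2"
  shows "\<delta>2 c \<in> carrier C3"
proof -
  let ?P = "prod_topology T (prod_topology T T)"
  let ?D = "discrete_topology (carrier Z2)"
  have cc: "continuous_map (prod_topology T T) ?D c"
    using c by (simp add: carrier_continuous_functions)
  have p1: "continuous_map ?P T fst" by (rule continuous_map_fst)
  have p2: "continuous_map ?P T (\<lambda>p. fst (snd p))"
    using continuous_map_compose[OF continuous_map_snd continuous_map_fst] by (simp add: o_def)
  have p3: "continuous_map ?P T (\<lambda>p. snd (snd p))"
    using continuous_map_compose[OF continuous_map_snd continuous_map_snd] by (simp add: o_def)
  have comp: "continuous_map ?P ?D (\<lambda>p. c (a p, b p))" if "continuous_map ?P T a" "continuous_map ?P T b" for a b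
    using continuous_map_compose[OF continuous_map_pairedI[OF that] cc] by (simp add: o_def)
  have add: "continuous_map ?P ?D (\<lambda>p. (a p + b p) mod 2)"
    if "continuous_map ?P ?D a" "continuous_map ?P ?D b" for a b
    using that by (intro continuous_map_discrete_comp2[where k = "\<lambda>a b. (a + b) mod 2"]) auto
  have "continuous_map ?P ?D (\<lambda>p. (((c (fst (snd p), snd (snd p)) + c (fst p \<otimes> fst (snd p), snd (snd p))) mod 2
      + c (fst p, fst (snd p) \<otimes> snd (snd p))) mod 2 + c (fst p, fst (snd p))) mod 2)"
    by (intro add comp continuous_map_mult p1 p2 p3)
  from continuous_functions_restrictI[OF this]
  have "(\<lambda>p\<in>carrier G \<times> carrier G \<times> carrier G. (c (fst (snd p), snd (snd p)) + c (fst p \<otimes> fst (snd p), snd (snd p))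
      + c (fst p, fst (snd p) \<otimes> snd (snd p)) + c (fst p, fst (snd p))) mod 2) \<in> carrier C3"
    by (simp add: topspace_eq mod_simps)
  moreover have "\<delta>2 c = (\<lambda>p\<in>carrier G \<times> carrier G \<times> carrier G. (c (fst (snd p), snd (snd p)) + c (fst p \<otimes> fst (snd p), snd (snd p))
      + c (fst p, fst (snd p) \<otimes> snd (snd p)) + c (fst p, fst (snd p))) mod 2)"
    using c by (auto simp: fun_eq_iff coboundary2_apply) (auto simp: coboundary2_def)
  ultimately show ?thesis by simp
qed

lemma comm_group_C: "comm_group C1" "comm_group C2" "comm_group C3"
  by (rule comm_group_continuous_functions, simp)+

lemma group_hom_coboundary1: "group_hom C1 C2 \<delta>1"
proof -
  interpret C1: comm_group C1 by (rule comm_group_C)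
  interpret C2: comm_group C2 by (rule comm_group_C)
  have "\<delta>1 (f \<otimes>\<^bsub>C1\<^esub> g) = \<delta>1 f \<otimes>\<^bsub>C2\<^esub> \<delta>1 g" if fg: "f \<in> carrier C1" "g \<in> carrier C1" for f g
  proof (rule extensionalityI[where A = "carrier G \<times> carrier G"])
    fix p assume "p \<in> carrier G \<times> carrier G"
    then show "\<delta>1 (f \<otimes>\<^bsub>C1\<^esub> g) p = (\<delta>1 f \<otimes>\<^bsub>C2\<^esub> \<delta>1 g) p"
      using coboundary1_apply[OF C1.m_closed[OF fg]] fg
      by (auto simp: coboundary1_apply topspace_eq add_mod2_interchange)
  qed (simp_all only: coboundary1_extensional mult_continuous_functions topspace_prod restrict_extensional)
  then have "\<delta>1 \<in> hom C1 C2" by (intro homI coboundary1_closed)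
  then show ?thesis by unfold_locales
qed

lemma group_hom_coboundary2: "group_hom C2 C3 \<delta>2"
proof -
  interpret C2: comm_group C2 by (rule comm_group_C)
  interpret C3: comm_group C3 by (rule comm_group_C)
  have "\<delta>2 (f \<otimes>\<^bsub>C2\<^esub> g) = \<delta>2 f \<otimes>\<^bsub>C3\<^esub> \<delta>2 g" if fg: "f \<in> carrier C2" "g \<in> carrier C2" for f g
  proof (rule extensionalityI[where A = "carrier G \<times> carrier G \<times> carrier G"])
    fix p assume "p \<in> carrier G \<times> carrier G \<times> carrier G"
    then show "\<delta>2 (f \<otimes>\<^bsub>C2\<^esub> g) p = (\<delta>2 f \<otimes>\<^bsub>C3\<^esub> \<delta>2 g) p"
      using coboundary2_apply[OF C2.m_closed[OF fg]] fg
      by (auto simp: coboundary2_apply topspace_eq add_mod2_interchange)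
  qed (simp_all only: coboundary2_extensional mult_continuous_functions topspace_prod restrict_extensional)
  then have "\<delta>2 \<in> hom C2 C3" by (intro homI coboundary2_closed)
  then show ?thesis by unfold_locales
qed

lemma carrier_cocycles2:
  "c \<in> carrier ZZ2 \<longleftrightarrow> c \<in> carrier C2 \<and>
     (\<forall>x\<in>carrier G. \<forall>y\<in>carrier G. \<forall>w\<in>carrier G.
        even (c (y, w) + c (x \<otimes> y, w) + c (x, y \<otimes> w) + c (x, y)))"
proof -
  have "\<delta>2 c = \<one>\<^bsub>C3\<^esub> \<longleftrightarrow> (\<forall>x\<in>carrier G. \<forall>y\<in>carrier G. \<forall>w\<in>carrier G.
        even (c (y, w) + c (x \<otimes> y, w) + c (x, y \<otimes> w) + c (x, y)))" if c: "c \<in> carrier C2"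
  proof -
    have "\<delta>2 c = \<one>\<^bsub>C3\<^esub> \<longleftrightarrow> (\<forall>p\<in>carrier G \<times> carrier G \<times> carrier G. \<delta>2 c p = 0)"
      by (auto simp: fun_eq_iff topspace_eq coboundary2_def restrict_def)
    also have "\<dots> \<longleftrightarrow> (\<forall>x\<in>carrier G. \<forall>y\<in>carrier G. \<forall>w\<in>carrier G. \<delta>2 c (x, y, w) = 0)" by auto
    also have "\<dots> \<longleftrightarrow> (\<forall>x\<in>carrier G. \<forall>y\<in>carrier G. \<forall>w\<in>carrier G.
        even (c (y, w) + c (x \<otimes> y, w) + c (x, y \<otimes> w) + c (x, y)))"
      by (intro ball_cong refl) (simp only: coboundary2_apply[OF c] even_iff_mod_2_eq_zero)
    finally show ?thesis .
  qed
  then show ?thesis by (auto simp: cocycles2_def kernel_def)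
qed

lemma carrier_H1:
  "\<psi> \<in> carrier HH1 \<longleftrightarrow> \<psi> \<in> carrier C1 \<and>
     (\<forall>x\<in>carrier G. \<forall>y\<in>carrier G. \<psi> (x \<otimes> y) = (\<psi> x + \<psi> y) mod 2)"
proof -
  have "\<delta>1 \<psi> = \<one>\<^bsub>C2\<^esub> \<longleftrightarrow> (\<forall>x\<in>carrier G. \<forall>y\<in>carrier G. \<psi> (x \<otimes> y) = (\<psi> x + \<psi> y) mod 2)"
    if c: "\<psi> \<in> carrier C1"
  proof -
    have "\<delta>1 \<psi> = \<one>\<^bsub>C2\<^esub> \<longleftrightarrow> (\<forall>p\<in>carrier G \<times> carrier G. \<delta>1 \<psi> p = 0)"
      by (auto simp: fun_eq_iff topspace_eq coboundary1_def restrict_def)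
    also have "\<dots> \<longleftrightarrow> (\<forall>x\<in>carrier G. \<forall>y\<in>carrier G. \<delta>1 \<psi> (x, y) = 0)" by auto
    also have "\<dots> \<longleftrightarrow> (\<forall>x\<in>carrier G. \<forall>y\<in>carrier G. \<psi> (x \<otimes> y) = (\<psi> x + \<psi> y) mod 2)"
    proof (intro ball_cong refl)
      fix x y assume "x \<in> carrier G" "y \<in> carrier G"
      then have "\<psi> (x \<otimes> y) \<in> {0, 1}" "\<delta>1 \<psi> (x, y) = (\<psi> x + \<psi> y + \<psi> (x \<otimes> y)) mod 2"
        using C1_values[OF c, of "x \<otimes> y"] c by (auto simp: carrier_Z2 coboundary1_apply)
      then show "(\<delta>1 \<psi> (x, y) = 0) = (\<psi> (x \<otimes> y) = (\<psi> x + \<psi> y) mod 2)" by (elim insertE emptyE; simp; presburger)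
    qed
    finally show ?thesis .
  qed
  then show ?thesis by (auto simp: H1_def kernel_def)
qed

lemma group_cocycles2: "comm_group ZZ2"
proof -
  interpret C2: comm_group C2 by (rule comm_group_C)
  interpret d: group_hom C2 C3 \<delta>2 by (rule group_hom_coboundary2)
  interpret Z: group ZZ2
    unfolding cocycles2_def by (rule C2.subgroup_imp_group[OF d.subgroup_kernel])
  show ?thesis
    by (rule Z.group_comm_groupI) (use C2.m_comm in \<open>auto simp: cocycles2_def kernel_def\<close>)
qed

lemma subgroup_coboundaries2: "subgroup BB2 ZZ2"
proof -
  interpret C1: comm_group C1 by (rule comm_group_C)
  interpret C2: comm_group C2 by (rule comm_group_C)
  interpret d: group_hom C1 C2 \<delta>1 by (rule group_hom_coboundary1)
  interpret d2: group_hom C2 C3 \<delta>2 by (rule group_hom_coboundary2)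
  have "\<delta>1 f \<in> carrier ZZ2" if f: "f \<in> carrier C1" for f
    unfolding carrier_cocycles2
  proof (intro conjI ballI)
    fix x y w assume xyw: "x \<in> carrier G" "y \<in> carrier G" "w \<in> carrier G"
    show "even (\<delta>1 f (y, w) + \<delta>1 f (x \<otimes> y, w) + \<delta>1 f (x, y \<otimes> w) + \<delta>1 f (x, y))"
      using even_coboundary_of_coboundary[of "f y" "f w" "f (y \<otimes> w)" "f (x \<otimes> y)" "f (x \<otimes> y \<otimes> w)" "f x"]
      by (simp only: coboundary1_apply[OF f] xyw m_closed m_assoc)
  qed (rule coboundary1_closed[OF f])
  then have "BB2 \<subseteq> carrier ZZ2" by (auto simp: coboundaries2_def)
  moreover have "subgroup BB2 C2" unfolding coboundaries2_def by (rule d.img_is_subgroup)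
  moreover have "subgroup (carrier ZZ2) C2" unfolding cocycles2_def using d2.subgroup_kernel by simp
  ultimately have "subgroup BB2 (C2\<lparr>carrier := carrier ZZ2\<rparr>)" by (simp add: C2.subgroup_incl)
  then show ?thesis by (simp add: cocycles2_def)
qed

end

section \<open>The cup product on the tensor square of the first cohomology group\<close>

context profinite_group
begin

definition cup_form :: "(('a \<Rightarrow> int) \<times> ('a \<Rightarrow> int) \<Rightarrow>\<^sub>0 int) \<Rightarrow> 'a \<Rightarrow> 'a \<Rightarrow> int" where
  "cup_form c x y = (\<Sum>p\<in>Poly_Mapping.keys c. Poly_Mapping.lookup c p * (fst p x * snd p y))"

text \<open>
  The 2-cocycle that represents the image of \<open>c\<close> under the cup product homomorphism.
\<close>

definition cup_cocycle :: "(('a \<Rightarrow> int) \<times> ('a \<Rightarrow> int) \<Rightarrow>\<^sub>0 int) \<Rightarrow> 'a \<times> 'a \<Rightarrow> int" where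
  "cup_cocycle c = (\<lambda>(x, y)\<in>carrier G \<times> carrier G. cup_form c x y mod 2)"

lemma cup_form_superset:
  assumes "finite A" "Poly_Mapping.keys c \<subseteq> A"
  shows "cup_form c x y = (\<Sum>p\<in>A. Poly_Mapping.lookup c p * (fst p x * snd p y))"
  unfolding cup_form_def using assms by (intro sum.mono_neutral_left) (auto simp: in_keys_iff)

lemma cup_form_add: "cup_form (c + d) x y = cup_form c x y + cup_form d x y"
proof -
  let ?A = "Poly_Mapping.keys c \<union> Poly_Mapping.keys d"
  have "cup_form (c + d) x y = (\<Sum>p\<in>?A. Poly_Mapping.lookup (c + d) p * (fst p x * snd p y))"
    "cup_form c x y = (\<Sum>p\<in>?A. Poly_Mapping.lookup c p * (fst p x * snd p y))"
    "cup_form d x y = (\<Sum>p\<in>?A. Poly_Mapping.lookup d p * (fst p x * snd p y))"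
    using keys_add[of c d] by (auto intro!: cup_form_superset)
  then show ?thesis by (simp add: lookup_add ring_distribs sum.distrib)
qed

lemma cup_form_uminus: "cup_form (- c) x y = - cup_form c x y"
  by (simp add: cup_form_def sum_negf)

lemma cup_form_diff: "cup_form (c - d) x y = cup_form c x y - cup_form d x y"
  using cup_form_add[of c "- d" x y] by (simp add: cup_form_uminus)

lemma cup_form_frag_of [simp]: "cup_form (frag_of (\<psi>, \<psi>')) x y = \<psi> x * \<psi>' y"
  by (simp add: cup_form_def keys_frag_of)

lemma cup_form_0 [simp]: "cup_form 0 x y = 0"
  by (simp add: cup_form_def)

lemma cup_cocycle_apply: "x \<in> carrier G \<Longrightarrow> y \<in> carrier G \<Longrightarrow> cup_cocycle c (x, y) = cup_form c x y mod 2"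
  by (simp add: cup_cocycle_def)

lemma cup_cocycle_eqI:
  assumes "\<And>x y. x \<in> carrier G \<Longrightarrow> y \<in> carrier G \<Longrightarrow> even (cup_form c x y - cup_form d x y)"
  shows "cup_cocycle c = cup_cocycle d"
  unfolding cup_cocycle_def by (rule restrict_ext) (use assms in \<open>auto simp: mod_eq_dvd_iff simp del: even_diff\<close>)

abbreviation "FF \<equiv> free_Abelian_group (carrier HH1 \<times> carrier HH1)"

lemma mult_cocycles2: "c \<otimes>\<^bsub>ZZ2\<^esub> d = (\<lambda>p\<in>carrier G \<times> carrier G. (c p + d p) mod 2)"
  by (simp add: cocycles2_def topspace_eq)

lemma one_cocycles2: "\<one>\<^bsub>ZZ2\<^esub> = cup_cocycle 0"
  by (simp add: cocycles2_def topspace_eq cup_cocycle_def fun_eq_iff restrict_def)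

lemma cup_cocycle_add: "cup_cocycle (c + d) = cup_cocycle c \<otimes>\<^bsub>ZZ2\<^esub> cup_cocycle d"
  unfolding mult_cocycles2 unfolding cup_cocycle_def
  by (rule restrict_ext) (auto simp: cup_form_add mod_simps)

lemma cup_cocycle_diff: "cup_cocycle (c - d) = cup_cocycle c \<otimes>\<^bsub>ZZ2\<^esub> cup_cocycle d"
  unfolding cup_cocycle_add[symmetric] by (rule cup_cocycle_eqI) (simp add: cup_form_add cup_form_diff)

lemma cup_cocycle_frag_of_closed:
  assumes \<psi>: "\<psi> \<in> carrier HH1" and \<psi>': "\<psi>' \<in> carrier HH1"
  shows "cup_cocycle (frag_of (\<psi>, \<psi>')) \<in> carrier ZZ2"
proof -
  let ?P = "prod_topology T T" and ?D = "discrete_topology (carrier Z2)"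
  have c: "continuous_map T ?D \<psi>" "continuous_map T ?D \<psi>'"
    using \<psi> \<psi>' by (simp_all add: carrier_H1 carrier_continuous_functions)
  have "continuous_map ?P ?D (\<lambda>p. \<psi> (fst p))" "continuous_map ?P ?D (\<lambda>p. \<psi>' (snd p))"
    using continuous_map_compose[OF continuous_map_fst c(1)] continuous_map_compose[OF continuous_map_snd c(2)]
    by (simp_all add: o_def)
  then have "continuous_map ?P ?D (\<lambda>p. \<psi> (fst p) * \<psi>' (snd p) mod 2)"
    by (rule continuous_map_discrete_comp2[where k = "\<lambda>a b. a * b mod 2"]) simp
  from continuous_functions_restrictI[OF this]
  have "(\<lambda>p\<in>carrier G \<times> carrier G. \<psi> (fst p) * \<psi>' (snd p) mod 2) \<in> carrier C2"
    by (simp add: topspace_eq)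
  moreover have "cup_cocycle (frag_of (\<psi>, \<psi>')) = (\<lambda>p\<in>carrier G \<times> carrier G. \<psi> (fst p) * \<psi>' (snd p) mod 2)"
    unfolding cup_cocycle_def by (rule restrict_ext) auto
  moreover have "even (cup_cocycle (frag_of (\<psi>, \<psi>')) (y, w) + cup_cocycle (frag_of (\<psi>, \<psi>')) (x \<otimes> y, w)
      + cup_cocycle (frag_of (\<psi>, \<psi>')) (x, y \<otimes> w) + cup_cocycle (frag_of (\<psi>, \<psi>')) (x, y))"
    if xyw: "x \<in> carrier G" "y \<in> carrier G" "w \<in> carrier G" for x y w
  proof -
    have "\<psi> (x \<otimes> y) = (\<psi> x + \<psi> y) mod 2" "\<psi>' (y \<otimes> w) = (\<psi>' y + \<psi>' w) mod 2"
      using \<psi> \<psi>' xyw by (auto simp: carrier_H1)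
    moreover have "\<psi> x \<in> {0, 1}" "\<psi> y \<in> {0, 1}" "\<psi>' y \<in> {0, 1}" "\<psi>' w \<in> {0, 1}"
      using \<psi> \<psi>' xyw C1_values unfolding carrier_H1 carrier_Z2 by blast+
    ultimately show ?thesis using xyw by (auto simp: cup_cocycle_apply)
  qed
  ultimately show ?thesis unfolding carrier_cocycles2 by simp
qed

lemma cup_cocycle_closed:
  assumes "c \<in> carrier FF"
  shows "cup_cocycle c \<in> carrier ZZ2"
proof -
  interpret Z: comm_group ZZ2 by (rule group_cocycles2)
  have "Poly_Mapping.keys c \<subseteq> carrier HH1 \<times> carrier HH1" using assms by simp
  then show ?thesis
  proof (rule free_Abelian_group_induct[where P = "\<lambda>c. cup_cocycle c \<in> carrier ZZ2"])
    show "cup_cocycle 0 \<in> carrier ZZ2" using Z.one_closed by (simp add: one_cocycles2)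
    show "cup_cocycle (c - d) \<in> carrier ZZ2" if "cup_cocycle c \<in> carrier ZZ2" "cup_cocycle d \<in> carrier ZZ2" for c d
      unfolding cup_cocycle_diff using that by (rule Z.m_closed)
    show "cup_cocycle (frag_of p) \<in> carrier ZZ2" if "p \<in> carrier HH1 \<times> carrier HH1" for p
      using that cup_cocycle_frag_of_closed by (cases p) auto
  qed
qed

lemma comm_group_H2: "comm_group HH2"
  unfolding H2_def by (rule comm_group.abelian_FactGroup[OF group_cocycles2 subgroup_coboundaries2])

abbreviation "cls c \<equiv> BB2 #>\<^bsub>ZZ2\<^esub> c"

lemma hom_class_cup_cocycle: "(\<lambda>c. cls (cup_cocycle c)) \<in> hom FF HH2"
proof -
  interpret Z: comm_group ZZ2 by (rule group_cocycles2)
  interpret B: normal BB2 ZZ2 using subgroup_coboundaries2 Z.normal_iff_subgroup by blast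
  have "cup_cocycle \<in> hom FF ZZ2" by (rule homI) (simp_all add: cup_cocycle_closed cup_cocycle_add del: carrier_free_Abelian_group_iff)
  from Group.hom_compose[OF this B.r_coset_hom_Mod] show ?thesis by (simp add: H2_def o_def)
qed

lemma cup_eq: "cup G T \<psi> \<psi>' = cls (cup_cocycle (frag_of (\<psi>, \<psi>')))"
  by (simp add: cup_def cup_cocycle_def)

lemma class_eq_one_iff:
  assumes "c \<in> carrier ZZ2"
  shows "cls c = \<one>\<^bsub>HH2\<^esub> \<longleftrightarrow> (\<exists>f\<in>carrier C1. \<delta>1 f = c)"
proof -
  interpret Z: comm_group ZZ2 by (rule group_cocycles2)
  show ?thesis using Z.r_coset_eq_subgroup_iff[OF subgroup_coboundaries2 assms]
    by (auto simp: H2_def coboundaries2_def)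
qed

lemma H1_mult: "\<psi> \<otimes>\<^bsub>HH1\<^esub> \<psi>' = (\<lambda>x\<in>carrier G. (\<psi> x + \<psi>' x) mod 2)"
  by (simp add: H1_def topspace_eq)

lemma H1_mult_closed:
  assumes "\<psi> \<in> carrier HH1" "\<psi>' \<in> carrier HH1"
  shows "\<psi> \<otimes>\<^bsub>HH1\<^esub> \<psi>' \<in> carrier HH1"
proof -
  interpret C1: comm_group C1 by (rule comm_group_C)
  interpret d: group_hom C1 C2 \<delta>1 by (rule group_hom_coboundary1)
  interpret H: group HH1
    unfolding H1_def by (rule C1.subgroup_imp_group[OF d.subgroup_kernel])
  show ?thesis using assms by (rule H.m_closed)
qed

text \<open>
  Bilinearity holds for cocycles, not just for their classes, so the defining relations of the tensor product map
  to the zero cocycle.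
\<close>

lemma cup_cocycle_tensor_relations:
  assumes "r \<in> tensor_relations HH1 HH1"
  shows "r \<in> carrier FF" "cup_cocycle r = cup_cocycle 0"
proof -
  let ?K = "{r \<in> carrier FF. cup_cocycle r = cup_cocycle 0}"
  interpret F: group FF by simp
  have sub: "subgroup ?K FF"
  proof (rule F.subgroupI)
    show "?K \<noteq> {}" by (auto intro!: exI[of _ 0])
    show "inv\<^bsub>FF\<^esub> r \<in> ?K" if "r \<in> ?K" for r
    proof -
      have "cup_cocycle (- r) = cup_cocycle r" by (rule cup_cocycle_eqI) (simp add: cup_form_uminus)
      then show ?thesis using that by simp
    qed
    show "r \<otimes>\<^bsub>FF\<^esub> s \<in> ?K" if "r \<in> ?K" "s \<in> ?K" for r s
    proof -
      have "cup_cocycle (r + s) = cup_cocycle (0 + 0)" using that unfolding cup_cocycle_add by simp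
      then show ?thesis using that keys_add[of r s] by auto
    qed
  qed auto
  have rel1: "frag_of (a \<otimes>\<^bsub>HH1\<^esub> a', b) - frag_of (a, b) - frag_of (a', b) \<in> ?K"
    if "a \<in> carrier HH1" "a' \<in> carrier HH1" "b \<in> carrier HH1" for a a' b
  proof -
    have "cup_cocycle (frag_of (a \<otimes>\<^bsub>HH1\<^esub> a', b) - frag_of (a, b) - frag_of (a', b)) = cup_cocycle 0"
    proof (rule cup_cocycle_eqI)
      fix x y assume "x \<in> carrier G" "y \<in> carrier G"
      then show "even (cup_form (frag_of (a \<otimes>\<^bsub>HH1\<^esub> a', b) - frag_of (a, b) - frag_of (a', b)) x y - cup_form 0 x y)"
        by (simp add: cup_form_diff H1_mult) blast
    qed
    moreover have "frag_of (a \<otimes>\<^bsub>HH1\<^esub> a', b) - frag_of (a, b) - frag_of (a', b) \<in> carrier FF"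
      using that H1_mult_closed by (simp add: keys_frag_of keys_diff[THEN subset_trans])
    ultimately show ?thesis by blast
  qed
  have rel2: "frag_of (a, b \<otimes>\<^bsub>HH1\<^esub> b') - frag_of (a, b) - frag_of (a, b') \<in> ?K"
    if "a \<in> carrier HH1" "b \<in> carrier HH1" "b' \<in> carrier HH1" for a b b'
  proof -
    have "cup_cocycle (frag_of (a, b \<otimes>\<^bsub>HH1\<^esub> b') - frag_of (a, b) - frag_of (a, b')) = cup_cocycle 0"
    proof (rule cup_cocycle_eqI)
      fix x y assume "x \<in> carrier G" "y \<in> carrier G"
      then show "even (cup_form (frag_of (a, b \<otimes>\<^bsub>HH1\<^esub> b') - frag_of (a, b) - frag_of (a, b')) x y - cup_form 0 x y)"
        by (simp add: cup_form_diff H1_mult) blast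
    qed
    moreover have "frag_of (a, b \<otimes>\<^bsub>HH1\<^esub> b') - frag_of (a, b) - frag_of (a, b') \<in> carrier FF"
      using that H1_mult_closed by (simp add: keys_frag_of keys_diff[THEN subset_trans])
    ultimately show ?thesis by blast
  qed
  have "tensor_relations HH1 HH1 \<subseteq> ?K"
    unfolding tensor_relations_def
    by (rule F.generate_subgroup_incl[OF _ sub]) (use rel1 rel2 in blast)
  then show "r \<in> carrier FF" "cup_cocycle r = cup_cocycle 0" using assms by blast+
qed

lemma normal_tensor_relations: "tensor_relations HH1 HH1 \<lhd> FF"
proof -
  interpret F: comm_group FF by (rule abelian_free_Abelian_group)
  let ?S = "{frag_of (a \<otimes>\<^bsub>HH1\<^esub> a', b) - frag_of (a, b) - frag_of (a', b) | a a' b.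
      a \<in> carrier HH1 \<and> a' \<in> carrier HH1 \<and> b \<in> carrier HH1} \<union>
    {frag_of (a, b \<otimes>\<^bsub>HH1\<^esub> b') - frag_of (a, b) - frag_of (a, b') | a b b'.
      a \<in> carrier HH1 \<and> b \<in> carrier HH1 \<and> b' \<in> carrier HH1}"
  have "?S \<subseteq> carrier FF"
  proof
    fix r assume "r \<in> ?S"
    then have "r \<in> tensor_relations HH1 HH1" unfolding tensor_relations_def by (rule generate.incl)
    then show "r \<in> carrier FF" by (rule cup_cocycle_tensor_relations)
  qed
  then show ?thesis
    unfolding F.normal_iff_subgroup tensor_relations_def by (rule F.generate_is_subgroup)
qed

abbreviation "RR \<equiv> tensor_relations HH1 HH1"

lemma cup_cocycle_coset:
  assumes "d \<in> RR #>\<^bsub>FF\<^esub> c"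
  shows "cup_cocycle d = cup_cocycle c"
proof -
  obtain r where "r \<in> RR" "d = r + c" using assms by (auto simp: r_coset_def)
  then have "cup_cocycle d = cup_cocycle (0 + c)" using cup_cocycle_tensor_relations(2)[of r] by (simp only: cup_cocycle_add)
  then show ?thesis by simp
qed

text \<open>
  The cocycle of \<open>c\<close> depends additively on \<open>c\<close>, so its class agrees with the linear extension of the
  cup product.
\<close>

lemma tensor_lift_cup:
  assumes c: "c \<in> carrier FF"
  shows "tensor_lift HH2 (cup G T) (RR #>\<^bsub>FF\<^esub> c) = cls (cup_cocycle c)"
proof -
  interpret R: normal RR FF by (rule normal_tensor_relations)
  interpret H: comm_group HH2 by (rule comm_group_H2)
  have "finprod HH2 (\<lambda>(a, b). cup G T a b [^]\<^bsub>HH2\<^esub> Poly_Mapping.lookup t (a, b)) (Poly_Mapping.keys t) = cls (cup_cocycle c)"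
    if t: "t \<in> RR #>\<^bsub>FF\<^esub> c" for t
  proof -
    have "t \<in> carrier FF" using t c R.elemrcos_carrier[OF R.is_group] by blast
    then have "cls (cup_cocycle t) = finprod HH2 (\<lambda>p. cls (cup_cocycle (frag_of p)) [^]\<^bsub>HH2\<^esub> Poly_Mapping.lookup t p) (Poly_Mapping.keys t)"
      by (intro hom_free_Abelian_group_finprod[OF comm_group_H2 hom_class_cup_cocycle]) simp
    moreover have "(\<lambda>p. cls (cup_cocycle (frag_of p)) [^]\<^bsub>HH2\<^esub> Poly_Mapping.lookup t p)
        = (\<lambda>(a, b). cup G T a b [^]\<^bsub>HH2\<^esub> Poly_Mapping.lookup t (a, b))"
      by (auto simp: cup_eq fun_eq_iff)
    ultimately show ?thesis using cup_cocycle_coset[OF t] by simp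
  qed
  moreover have "c \<in> RR #>\<^bsub>FF\<^esub> c" using R.rcos_self[OF c R.subgroup_axioms] .
  ultimately have "(\<lambda>t. finprod HH2 (\<lambda>(a, b). cup G T a b [^]\<^bsub>HH2\<^esub> Poly_Mapping.lookup t (a, b)) (Poly_Mapping.keys t))
      ` (RR #>\<^bsub>FF\<^esub> c) = {cls (cup_cocycle c)}" by (auto simp: image_iff intro!: bexI[of _ c])
  then show ?thesis unfolding tensor_lift_def by simp
qed

lemma tensor_lift_cup_eq_one_iff:
  assumes "c \<in> carrier FF"
  shows "tensor_lift HH2 (cup G T) (RR #>\<^bsub>FF\<^esub> c) = \<one>\<^bsub>HH2\<^esub> \<longleftrightarrow> (\<exists>f\<in>carrier C1. \<delta>1 f = cup_cocycle c)"
  using tensor_lift_cup[OF assms] class_eq_one_iff[OF cup_cocycle_closed[OF assms]] by simp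

text \<open>
  The kernel of a continuous character is a closed subgroup that contains all squares and commutators.
\<close>

lemma character_trivial_on_D2:
  assumes \<psi>: "\<psi> \<in> carrier HH1" and g: "g \<in> D 2"
  shows "\<psi> g = 0"
proof -
  have \<psi>_mult: "\<psi> (x \<otimes> y) = (\<psi> x + \<psi> y) mod 2" if "x \<in> carrier G" "y \<in> carrier G" for x y
    using \<psi> that by (auto simp: carrier_H1)
  have \<psi>_val: "\<psi> x \<in> {0, 1}" if "x \<in> carrier G" for x
    using \<psi> that C1_values by (auto simp: carrier_H1 carrier_Z2)
  have \<psi>_one: "\<psi> \<one> = 0" using \<psi>_mult[of \<one> \<one>] \<psi>_val[of \<one>] by auto
  have \<psi>_inv: "\<psi> (inv x) = \<psi> x" if "x \<in> carrier G" for x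
    using \<psi>_mult[of "inv x" x] \<psi>_val[of "inv x"] \<psi>_val[of x] that \<psi>_one by auto
  let ?K = "{x \<in> carrier G. \<psi> x = 0}"
  have "subgroup ?K G"
    by (rule subgroupI) (use \<psi>_mult \<psi>_one \<psi>_inv in auto)
  moreover have "closedin T ?K"
    using closedin_continuous_map_preimage[of T "discrete_topology (carrier Z2)" \<psi> "{0}"] \<psi>
    by (simp add: carrier_H1 carrier_continuous_functions topspace_eq carrier_Z2)
  moreover have "{h \<otimes> h | h. h \<in> carrier G} \<union> {inv h \<otimes> inv x \<otimes> h \<otimes> x | h x. h \<in> carrier G \<and> x \<in> carrier G} \<subseteq> ?K"
  proof -
    have "\<psi> (h \<otimes> h) = 0" if "h \<in> carrier G" for h using that by (simp add: \<psi>_mult)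
    moreover have "\<psi> (inv h \<otimes> inv x \<otimes> h \<otimes> x) = 0" if "h \<in> carrier G" "x \<in> carrier G" for h x
      using that \<psi>_val[of h] \<psi>_val[of x] by (auto simp: \<psi>_mult \<psi>_inv)
    ultimately show ?thesis by auto
  qed
  ultimately have "D 2 \<subseteq> ?K"
    using D_Suc[of 0] closed_subgroup_generated_minimal by (simp add: D_1 numeral_2_eq_2)
  then show ?thesis using g by blast
qed

text \<open>
  The formal sums whose cocycle is the coboundary of a cochain vanishing at \<open>g\<close> are closed under addition and
  negation and contain the relations. Therefore, once the generators \<open>S\<close> of the kernel are represented by
  such sums, all of the kernel is.
\<close>

lemma cochain_vanishing_of_pure_tensors:
  assumes S: "S \<subseteq> {pure_tensor HH1 HH1 \<psi> \<psi>' | \<psi> \<psi>'. \<psi> \<in> carrier HH1 \<and> \<psi>' \<in> carrier HH1}"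
    and ker: "kernel (tensor_product HH1 HH1) HH2 (tensor_lift HH2 (cup G T)) = generate (tensor_product HH1 HH1) S"
    and g: "g \<in> carrier G"
    and pure: "\<And>\<psi> \<psi>' f. \<psi> \<in> carrier HH1 \<Longrightarrow> \<psi>' \<in> carrier HH1 \<Longrightarrow> f \<in> carrier C1 \<Longrightarrow>
      \<delta>1 f = cup_cocycle (frag_of (\<psi>, \<psi>')) \<Longrightarrow> f g = 0"
    and c: "c \<in> carrier FF" "f \<in> carrier C1" "\<delta>1 f = cup_cocycle c"
  obtains f' where "f' \<in> carrier C1" "\<delta>1 f' = cup_cocycle c" "f' g = 0"
proof -
  interpret F: group FF by simp
  interpret R: normal RR FF by (rule normal_tensor_relations)
  interpret C1: comm_group C1 by (rule comm_group_C)
  interpret d: group_hom C1 C2 \<delta>1 by (rule group_hom_coboundary1)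
  note [simp del] = carrier_free_Abelian_group_iff
  define P where "P = {d \<in> carrier FF. \<exists>f\<in>carrier C1. \<delta>1 f = cup_cocycle d \<and> f g = 0}"
  have C1_mult: "(f1 \<otimes>\<^bsub>C1\<^esub> f2) g = (f1 g + f2 g) mod 2" for f1 f2 using g by (simp add: topspace_eq)
  have ZC: "c1 \<otimes>\<^bsub>ZZ2\<^esub> c2 = c1 \<otimes>\<^bsub>C2\<^esub> c2" for c1 c2 by (simp add: cocycles2_def)
  have PI: "d \<in> P" if "d \<in> carrier FF" "f \<in> carrier C1" "\<delta>1 f = cup_cocycle d" "f g = 0" for d f
    unfolding P_def using that by (intro CollectI conjI bexI[of _ f])
  have PE: "\<exists>f\<in>carrier C1. \<delta>1 f = cup_cocycle d \<and> f g = 0" "d \<in> carrier FF" if "d \<in> P" for d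
    using that unfolding P_def by simp_all
  have P_add: "d + e \<in> P" if de: "d \<in> P" "e \<in> P" for d e
  proof -
    obtain f1 where f1: "f1 \<in> carrier C1" "\<delta>1 f1 = cup_cocycle d" "f1 g = 0" using PE(1)[OF de(1)] by (elim bexE conjE)
    obtain f2 where f2: "f2 \<in> carrier C1" "\<delta>1 f2 = cup_cocycle e" "f2 g = 0" using PE(1)[OF de(2)] by (elim bexE conjE)
    show ?thesis
    proof (rule PI)
      show "f1 \<otimes>\<^bsub>C1\<^esub> f2 \<in> carrier C1" using f1(1) f2(1) by (rule C1.m_closed)
      show "\<delta>1 (f1 \<otimes>\<^bsub>C1\<^esub> f2) = cup_cocycle (d + e)"
        unfolding cup_cocycle_add ZC d.hom_mult[OF f1(1) f2(1)] f1(2) f2(2) by (rule refl)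
      show "(f1 \<otimes>\<^bsub>C1\<^esub> f2) g = 0" unfolding C1_mult f1(3) f2(3) by simp
      show "d + e \<in> carrier FF" using F.m_closed[of d e] PE(2) de by simp
    qed
  qed
  have P_uminus: "- d \<in> P" if "d \<in> P" for d
  proof -
    have "cup_cocycle (- d) = cup_cocycle d" by (rule cup_cocycle_eqI) (simp add: cup_form_uminus)
    moreover have "- d \<in> carrier FF" using that F.inv_closed[of d] by (simp add: P_def carrier_free_Abelian_group_iff)
    ultimately show ?thesis using that unfolding P_def by simp
  qed
  have P_zero: "0 \<in> P"
  proof -
    have one: "\<delta>1 \<one>\<^bsub>C1\<^esub> = cup_cocycle 0" "\<one>\<^bsub>C1\<^esub> g = 0"
      using d.hom_one one_cocycles2 g by (simp_all add: cocycles2_def topspace_eq)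
    show ?thesis by (rule PI[OF _ C1.one_closed one]) (use F.one_closed in simp)
  qed
  have S_P: "\<exists>d\<in>P. K = RR #>\<^bsub>FF\<^esub> d" if K: "K \<in> S" for K
  proof -
    obtain \<psi> \<psi>' where \<psi>: "\<psi> \<in> carrier HH1" "\<psi>' \<in> carrier HH1" "K = RR #>\<^bsub>FF\<^esub> frag_of (\<psi>, \<psi>')"
      using S K by (auto simp: pure_tensor_def)
    have d: "frag_of (\<psi>, \<psi>') \<in> carrier FF" using \<psi> by simp
    have "K \<in> kernel (tensor_product HH1 HH1) HH2 (tensor_lift HH2 (cup G T))"
      unfolding ker using K by (rule generate.incl)
    then have "tensor_lift HH2 (cup G T) K = \<one>\<^bsub>HH2\<^esub>" by (simp add: kernel_def)
    then obtain f where f: "f \<in> carrier C1" "\<delta>1 f = cup_cocycle (frag_of (\<psi>, \<psi>'))"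
      using tensor_lift_cup_eq_one_iff[OF d] \<psi>(3) by blast
    then have "frag_of (\<psi>, \<psi>') \<in> P" using pure[OF \<psi>(1,2) f] d by (intro PI)
    then show ?thesis using \<psi> by blast
  qed
  have gen: "\<exists>d\<in>P. K = RR #>\<^bsub>FF\<^esub> d" if "K \<in> generate (tensor_product HH1 HH1) S" for K
    using that
  proof (induction K rule: generate.induct)
    case one
    show ?case using P_zero R.subset F.coset_mult_one[of RR, OF R.subset] by (intro bexI[of _ 0]) (simp_all add: tensor_product_def)
  next
    case (incl K)
    then show ?case by (rule S_P)
  next
    case (inv K)
    then obtain d where d: "d \<in> P" "K = RR #>\<^bsub>FF\<^esub> d" using S_P by blast
    then have "d \<in> carrier FF" by (simp add: P_def)
    then have "inv\<^bsub>tensor_product HH1 HH1\<^esub> K = RR #>\<^bsub>FF\<^esub> (- d)"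
      using d R.inv_FactGroup[of K] R.rcos_inv[of d]
      by (simp add: tensor_product_def carrier_FactGroup carrier_free_Abelian_group_iff)
    then show ?case using P_uminus d by blast
  next
    case (eng K L)
    then obtain d e where d: "d \<in> P" "K = RR #>\<^bsub>FF\<^esub> d" and e: "e \<in> P" "L = RR #>\<^bsub>FF\<^esub> e" by blast
    then have "d \<in> carrier FF" "e \<in> carrier FF" by (simp_all add: P_def)
    then have "K \<otimes>\<^bsub>tensor_product HH1 HH1\<^esub> L = RR #>\<^bsub>FF\<^esub> (d + e)"
      using d e R.rcos_sum[of d e] by (simp add: tensor_product_def)
    then show ?case using P_add d e by blast
  qed
  have "RR #>\<^bsub>FF\<^esub> c \<in> kernel (tensor_product HH1 HH1) HH2 (tensor_lift HH2 (cup G T))"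
    using tensor_lift_cup_eq_one_iff[OF c(1)] c by (auto simp: kernel_def tensor_product_def carrier_FactGroup)
  then obtain d where d: "d \<in> P" "RR #>\<^bsub>FF\<^esub> c = RR #>\<^bsub>FF\<^esub> d" using gen ker by blast
  then have "cup_cocycle c = cup_cocycle d" using cup_cocycle_coset F.rcos_self[OF c(1) R.subgroup_axioms] by metis
  moreover obtain f' where "f' \<in> carrier C1" "\<delta>1 f' = cup_cocycle d" "f' g = 0" using PE(1)[OF d(1)] by (elim bexE conjE)
  ultimately show thesis using that by metis
qed

end

section \<open>Vanishing cup products and quotients of order 2, 4 and 8\<close>

lemma mod2_eqI: "(a::int) \<in> {0, 1} \<Longrightarrow> even (a + b) \<Longrightarrow> a = b mod 2"
  by (elim insertE emptyE) (simp_all, presburger+)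

lemma carrier_D4: "carrier D4 = {0, 1, 2, 3} \<times> {0, 1}"
proof -
  have "{0..<4} = {0, 1, 2, 3::int}" "{0..<2} = {0, 1::int}" by auto
  then show ?thesis by (simp only: D4_def partial_object.select_convs)
qed

context profinite_group
begin

lemma open_kernel_quotient:
  assumes "group K" and \<rho>: "\<rho> \<in> hom G K" "\<rho> ` carrier G = carrier K"
    and cont: "continuous_map T (discrete_topology (carrier K)) \<rho>"
  shows "kernel G K \<rho> \<lhd> G \<and> openin T (kernel G K \<rho>) \<and> G Mod kernel G K \<rho> \<cong> K"
proof -
  interpret K: group K by (rule assms)
  interpret \<rho>: group_hom G K \<rho> using \<rho>(1) by unfold_locales
  have "kernel G K \<rho> = {x \<in> topspace T. \<rho> x \<in> {\<one>\<^bsub>K\<^esub>}}" by (simp add: kernel_def topspace_eq)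
  moreover have "openin T {x \<in> topspace T. \<rho> x \<in> {\<one>\<^bsub>K\<^esub>}}"
    by (rule openin_continuous_map_preimage[OF cont]) simp
  ultimately show ?thesis
    using \<rho>.normal_kernel \<rho>.FactGroup_iso_set[OF \<rho>(2)] by (auto simp: is_iso_def)
qed

text \<open>
  A cochain \<open>f\<close> with coboundary \<open>\<psi>(x) \<psi>'(y)\<close> is the missing coordinate of a homomorphism to \<open>\<int>/4\<close> or
  \<open>D4\<close> that lifts \<open>(\<psi>, \<psi>')\<close>; its kernel contains \<open>g\<close>, so that coordinate vanishes at \<open>g\<close>. If one
  of the two characters is zero, then \<open>f\<close> is itself a character.
\<close>

lemma vanishing_on_intersection_of_kernels:
  assumes \<psi>: "\<psi> \<in> carrier HH1" "\<psi>' \<in> carrier HH1" and f: "f \<in> carrier C1"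
    and df: "\<And>x y. x \<in> carrier G \<Longrightarrow> y \<in> carrier G \<Longrightarrow> even (f (x \<otimes> y) + f x + f y + \<psi> x * \<psi>' y)"
    and gc: "g \<in> carrier G"
    and kills: "\<And>\<phi>. \<phi> \<in> carrier HH1 \<Longrightarrow> \<phi> g = 0"
    and N: "\<And>N. N \<lhd> G \<Longrightarrow> openin T N \<Longrightarrow> G Mod N \<cong> integer_mod_group 4 \<or> G Mod N \<cong> D4 \<Longrightarrow> g \<in> N"
  shows "f g = 0"
proof -
  note g = gc kills[OF \<psi>(1)] kills[OF \<psi>(2)]
  have val: "\<psi> x \<in> {0, 1}" "\<psi>' x \<in> {0, 1}" "f x \<in> {0, 1}" if "x \<in> carrier G" for x
    using that \<psi> f C1_values unfolding carrier_H1 carrier_Z2 by blast+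
  have hom: "\<psi> (x \<otimes> y) = (\<psi> x + \<psi> y) mod 2" "\<psi>' (x \<otimes> y) = (\<psi>' x + \<psi>' y) mod 2"
    if "x \<in> carrier G" "y \<in> carrier G" for x y
    using that \<psi> unfolding carrier_H1 by blast+
  have f_mult: "f (x \<otimes> y) = (f x + f y + \<psi> x * \<psi>' y) mod 2" if "x \<in> carrier G" "y \<in> carrier G" for x y
    using mod2_eqI[OF val(3)[OF m_closed[OF that]]] df[OF that] by (simp add: add.assoc)
  have cont: "continuous_map T (discrete_topology {0, 1}) \<psi>" "continuous_map T (discrete_topology {0, 1}) \<psi>'"
    "continuous_map T (discrete_topology {0, 1}) f"
    using \<psi> f unfolding carrier_H1 carrier_continuous_functions carrier_Z2 by blast+
  consider (triv) "\<forall>x\<in>carrier G. \<forall>y\<in>carrier G. \<psi> x * \<psi>' y = 0"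
    | (eq) x where "\<forall>x\<in>carrier G. \<psi> x = \<psi>' x" "x \<in> carrier G" "\<psi> x = 1"
    | (neq) x y where "x \<in> carrier G" "\<psi> x = 1" "\<psi>' x = 0" "y \<in> carrier G" "\<psi> y = 0" "\<psi>' y = 1"
  proof (cases "(\<forall>x\<in>carrier G. \<psi> x = 0) \<or> (\<forall>x\<in>carrier G. \<psi>' x = 0)")
    case True
    then show thesis using that(1) by auto
  next
    case False
    then obtain x y where xy: "x \<in> carrier G" "\<psi> x = 1" "y \<in> carrier G" "\<psi>' y = 1" using val by blast
    show thesis
    proof (cases "\<forall>x\<in>carrier G. \<psi> x = \<psi>' x")
      case True
      then show thesis using that(2) xy by blast
    next
      case False
      then obtain u where u: "u \<in> carrier G" "\<psi> u \<noteq> \<psi>' u" by blast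
      consider "\<psi> u = 1" "\<psi>' u = 0" | "\<psi> u = 0" "\<psi>' u = 1" using u val[OF u(1)] by auto
      then show thesis
      proof cases
        case 1
        show thesis
        proof (cases "\<psi> y = 0")
          case True
          then show thesis using that(3)[of u y] 1 u xy by blast
        next
          case False
          then have "\<psi> y = 1" using val(1) xy(3) by blast
          then have "\<psi> (u \<otimes> y) = 0" "\<psi>' (u \<otimes> y) = 1" using hom[OF u(1) xy(3)] 1 xy by simp_all
          then show thesis using that(3)[of u "u \<otimes> y"] 1 u xy by blast
        qed
      next
        case 2
        show thesis
        proof (cases "\<psi>' x = 0")
          case True
          then show thesis using that(3)[of x u] 2 u xy by blast
        next
          case False
          then have "\<psi>' x = 1" using val(2) xy(1) by blast
          then have "\<psi> (u \<otimes> x) = 1" "\<psi>' (u \<otimes> x) = 0" using hom[OF u(1) xy(1)] 2 xy by simp_all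
          then show thesis using that(3)[of "u \<otimes> x" u] 2 u xy by blast
        qed
      qed
    qed
  qed
  then show ?thesis
  proof cases
    case triv
    then have "f (x \<otimes> y) = (f x + f y) mod 2" if "x \<in> carrier G" "y \<in> carrier G" for x y
      using f_mult[OF that] that by (simp del: mult_eq_0_iff)
    then have "f \<in> carrier HH1" using f unfolding carrier_H1 by blast
    then show ?thesis by (rule kills)
  next
    case (eq x)
    \<comment> \<open>The carry of \<open>\<psi>(u) + \<psi>(w)\<close> is \<open>\<psi>(u) \<psi>(w)\<close>, which is the coboundary of \<open>f\<close>.\<close>
    define \<rho> where "\<rho> = (\<lambda>w. (\<psi> w + 2 * f w) mod 4)"
    have hom4: "\<rho> \<in> hom G (integer_mod_group 4)"
    proof (rule homI)
      fix u w assume uw: "u \<in> carrier G" "w \<in> carrier G"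
      show "\<rho> (u \<otimes> w) = \<rho> u \<otimes>\<^bsub>integer_mod_group 4\<^esub> \<rho> w"
        unfolding \<rho>_def hom(1)[OF uw] f_mult[OF uw]
        using val[OF uw(1)] val[OF uw(2)] eq(1) uw by (elim insertE emptyE) simp_all
    qed (auto simp: \<rho>_def carrier_integer_mod_group)
    have rng: "\<rho> ` carrier G = carrier (integer_mod_group 4)"
    proof
      show "\<rho> ` carrier G \<subseteq> carrier (integer_mod_group 4)" by (auto simp: \<rho>_def carrier_integer_mod_group)
      have one: "\<rho> \<one> = 0" using hom_one[OF hom4 is_group] by simp
      have sq: "\<rho> (x \<otimes> x) = (\<rho> x + \<rho> x) mod 4" "\<rho> (x \<otimes> x \<otimes> x) = (\<rho> (x \<otimes> x) + \<rho> x) mod 4"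
        using hom_mult[OF hom4] eq(2) by simp_all
      have c4: "carrier (integer_mod_group 4) = {0, 1, 2, 3}" by (auto simp: carrier_integer_mod_group)
      have "\<rho> x \<in> {1, 3}" using eq val(3)[of x] by (auto simp: \<rho>_def)
      then have "{0, 1, 2, 3} \<subseteq> {\<rho> \<one>, \<rho> x, \<rho> (x \<otimes> x), \<rho> (x \<otimes> x \<otimes> x)}"
        unfolding sq one by (elim insertE emptyE) simp_all
      also have "\<dots> \<subseteq> \<rho> ` carrier G" using eq(2) by auto
      finally show "carrier (integer_mod_group 4) \<subseteq> \<rho> ` carrier G" unfolding c4 .
    qed
    have "continuous_map T (discrete_topology (carrier (integer_mod_group 4))) \<rho>"
      unfolding \<rho>_def using cont(1,3)
      by (rule continuous_map_discrete_comp2[where k = "\<lambda>a b. (a + 2 * b) mod 4"])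
         (auto simp: carrier_integer_mod_group)
    then have "g \<in> kernel G (integer_mod_group 4) \<rho>"
      using N open_kernel_quotient[OF _ hom4 rng] by simp
    then have "\<rho> g = 0" by (simp add: kernel_def)
    then show ?thesis using g val(3)[of g] by (auto simp: \<rho>_def)
  next
    case (neq x y)
    \<comment> \<open>Writing the exponent of a rotation as \<open>i = i\<^sub>0 + 2 i\<^sub>1\<close>, the product of \<open>(i, a)\<close> and \<open>(j, b)\<close> in \<open>D4\<close> has
    upper bit \<open>i\<^sub>1 + j\<^sub>1 + (i\<^sub>0 + a) j\<^sub>0\<close>. So \<open>f\<close> is the upper bit, \<open>\<psi>'\<close> is the lower bit \<open>i\<^sub>0\<close>,
    and \<open>\<psi>\<close> is \<open>i\<^sub>0 + a\<close>.\<close>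
    define \<rho> where "\<rho> = (\<lambda>w. ((\<psi>' w + 2 * f w) mod 4, (\<psi> w + \<psi>' w) mod 2))"
    have \<rho>_closed: "\<rho> w \<in> carrier D4" for w by (auto simp: \<rho>_def D4_def)
    have homD: "\<rho> \<in> hom G D4"
    proof (rule homI)
      fix u w assume uw: "u \<in> carrier G" "w \<in> carrier G"
      show "\<rho> (u \<otimes> w) = \<rho> u \<otimes>\<^bsub>D4\<^esub> \<rho> w"
        unfolding \<rho>_def hom[OF uw] f_mult[OF uw] D4_def
        using val[OF uw(1)] val[OF uw(2)] by (elim insertE emptyE) simp_all
    qed (rule \<rho>_closed)
    have rng: "\<rho> ` carrier G = carrier D4"
    proof
      show "\<rho> ` carrier G \<subseteq> carrier D4" using \<rho>_closed by blast
      show "carrier D4 \<subseteq> \<rho> ` carrier G"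
      proof
        fix p assume "p \<in> carrier D4"
        then obtain i a where p: "p = (i, a)" "i \<in> {0, 1, 2, 3}" "a \<in> {0, 1}"
          unfolding carrier_D4 by blast
        \<comment> \<open>The element \<open>x y\<close> goes to a rotation of order 4, so its square goes to the central rotation: multiplying by
        it flips \<open>f\<close> alone.\<close>
        let ?z = "(x \<otimes> y) \<otimes> (x \<otimes> y)"
        have z: "?z \<in> carrier G" "\<psi> ?z = 0" "\<psi>' ?z = 0" "f ?z = 1"
          using neq by (simp_all add: hom f_mult)
        have pick: "\<exists>w\<in>carrier G. \<psi> w = b \<and> \<psi>' w = c" if "b \<in> {0, 1}" "c \<in> {0, 1}" for b c
        proof -
          have "\<psi> (x \<otimes> y) = 1 \<and> \<psi>' (x \<otimes> y) = 1" using neq by (simp add: hom)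
          then show ?thesis using that neq z m_closed by blast
        qed
        have "(i + a) mod 2 \<in> {0, 1}" and "i mod 2 \<in> {0, 1}" by auto
        note pick = pick[OF this]
        obtain w where w: "w \<in> carrier G" "\<psi> w = (i + a) mod 2" "\<psi>' w = i mod 2"
          using pick by (elim bexE conjE)
        define u where "u = w \<otimes> ?z"
        have uc: "u \<in> carrier G" using w z(1) by (simp add: u_def)
        have u: "\<psi> u = (i + a) mod 2" "\<psi>' u = i mod 2" "f u = (f w + 1) mod 2"
          unfolding u_def hom(1)[OF w(1) z(1)] hom(2)[OF w(1) z(1)] f_mult[OF w(1) z(1)] z(2-4) w(2,3) by simp_all
        have "f w = i div 2 \<or> f u = i div 2"
          unfolding u(3) using p(2) val(3)[OF w(1)] by auto
        moreover have "\<rho> v = p" if "\<psi> v = (i + a) mod 2" "\<psi>' v = i mod 2" "f v = i div 2" for v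
          unfolding \<rho>_def that p(1) using p(2,3) by auto
        ultimately have "\<rho> w = p \<or> \<rho> u = p" using w(2,3) u(1,2) by blast
        then show "p \<in> \<rho> ` carrier G" using w(1) uc by blast
      qed
    qed
    have "continuous_map T (discrete_topology {0..<4}) (\<lambda>w. (\<psi>' w + 2 * f w) mod 4)"
      using cont(2,3) by (rule continuous_map_discrete_comp2[where k = "\<lambda>a b. (a + 2 * b) mod 4"]) simp
    moreover have "continuous_map T (discrete_topology {0..<2}) (\<lambda>w. (\<psi> w + \<psi>' w) mod 2)"
      using cont(1,2) by (rule continuous_map_discrete_comp2[where k = "\<lambda>a b. (a + b) mod 2"]) simp
    ultimately have "continuous_map T (discrete_topology (carrier D4)) \<rho>"
      unfolding \<rho>_def by (rule continuous_map_discrete_comp2[where k = Pair]) (simp add: D4_def)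
    from open_kernel_quotient[OF group_D4 homD rng this] have "g \<in> kernel G D4 \<rho>"
      using N by blast
    then have "\<rho> g = (0, 0)" by (simp add: kernel_def D4_def)
    then show ?thesis using g val(3)[of g] by (auto simp: \<rho>_def)
  qed
qed

end

section \<open>The third term as an intersection\<close>

text \<open>
  The identity is included, which makes this set a subgroup.
\<close>

definition central_involutions :: "('a, 'b) monoid_scheme \<Rightarrow> 'a set" where
  "central_involutions K =
     {z \<in> carrier K. z \<otimes>\<^bsub>K\<^esub> z = \<one>\<^bsub>K\<^esub> \<and> (\<forall>k\<in>carrier K. z \<otimes>\<^bsub>K\<^esub> k = k \<otimes>\<^bsub>K\<^esub> z)}"

lemma central_involutionsD:
  assumes "z \<in> central_involutions K"
  shows "z \<in> carrier K" "z \<otimes>\<^bsub>K\<^esub> z = \<one>\<^bsub>K\<^esub>" "k \<in> carrier K \<Longrightarrow> z \<otimes>\<^bsub>K\<^esub> k = k \<otimes>\<^bsub>K\<^esub> z"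
  using assms unfolding central_involutions_def by blast+

lemma (in group) subgroup_central_involutions: "subgroup (central_involutions G) G"
proof (rule subgroupI)
  show "central_involutions G \<subseteq> carrier G" by (auto simp: central_involutions_def)
  show "central_involutions G \<noteq> {}" by (auto simp: central_involutions_def intro!: exI[of _ \<one>])
next
  fix a assume a: "a \<in> central_involutions G"
  then have "inv a = a" using central_involutionsD(1,2)[OF a] by (intro inv_equality)
  then show "inv a \<in> central_involutions G" using a by simp
  fix b assume b: "b \<in> central_involutions G"
  note ab = central_involutionsD(1)[OF a] central_involutionsD(1)[OF b]
  have "(a \<otimes> b) \<otimes> (a \<otimes> b) = a \<otimes> (b \<otimes> a) \<otimes> b" using ab by (simp add: m_assoc)
  also have "\<dots> = (a \<otimes> a) \<otimes> (b \<otimes> b)"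
    unfolding central_involutionsD(3)[OF b ab(1)] using ab by (simp add: m_assoc)
  also have "\<dots> = \<one>"
    unfolding central_involutionsD(2)[OF a] central_involutionsD(2)[OF b] by simp
  finally have "(a \<otimes> b) \<otimes> (a \<otimes> b) = \<one>" .
  moreover have "(a \<otimes> b) \<otimes> k = k \<otimes> (a \<otimes> b)" if k: "k \<in> carrier G" for k
  proof -
    have "(a \<otimes> b) \<otimes> k = a \<otimes> (b \<otimes> k)" using ab k by (simp add: m_assoc)
    also have "\<dots> = (a \<otimes> k) \<otimes> b"
      unfolding central_involutionsD(3)[OF b k] using ab k by (simp add: m_assoc)
    also have "\<dots> = k \<otimes> (a \<otimes> b)"
      unfolding central_involutionsD(3)[OF a k] using ab k by (simp add: m_assoc)
    finally show ?thesis .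
  qed
  ultimately show "a \<otimes> b \<in> central_involutions G"
    unfolding central_involutions_def using m_closed[OF ab] by blast
qed

text \<open>
  The second term of the descending 2-central series of \<open>K\<close> then consists of central involutions and the identity, so
  the third term is trivial. The commutator occurs as the factor \<open>z\<close> with \<open>x y = y x z\<close>, which spares the computation
  of inverses in \<open>D4\<close>.
\<close>

definition squares_and_commutators_central :: "('a, 'b) monoid_scheme \<Rightarrow> bool" where
  "squares_and_commutators_central K \<longleftrightarrow>
     (\<forall>x\<in>carrier K. x \<otimes>\<^bsub>K\<^esub> x \<in> central_involutions K) \<and>
     (\<forall>x\<in>carrier K. \<forall>y\<in>carrier K. \<exists>z\<in>central_involutions K. x \<otimes>\<^bsub>K\<^esub> y = y \<otimes>\<^bsub>K\<^esub> x \<otimes>\<^bsub>K\<^esub> z)"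

lemma squares_and_commutators_central_comm:
  assumes "comm_group K" "\<And>x. x \<in> carrier K \<Longrightarrow> (x \<otimes>\<^bsub>K\<^esub> x) \<otimes>\<^bsub>K\<^esub> (x \<otimes>\<^bsub>K\<^esub> x) = \<one>\<^bsub>K\<^esub>"
  shows "squares_and_commutators_central K"
proof -
  interpret K: comm_group K by (rule assms(1))
  have "\<one>\<^bsub>K\<^esub> \<in> central_involutions K" by (simp add: central_involutions_def)
  moreover have "x \<otimes>\<^bsub>K\<^esub> y = y \<otimes>\<^bsub>K\<^esub> x \<otimes>\<^bsub>K\<^esub> \<one>\<^bsub>K\<^esub>" if "x \<in> carrier K" "y \<in> carrier K" for x y
    using that K.m_comm[of x y] by simp
  moreover have "x \<otimes>\<^bsub>K\<^esub> x \<in> central_involutions K" if "x \<in> carrier K" for x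
    unfolding central_involutions_def
    using that assms(2)[OF that] by (intro CollectI conjI ballI K.m_comm K.m_closed)
  ultimately show ?thesis unfolding squares_and_commutators_central_def by blast
qed

lemma squares_and_commutators_central_trivial:
  assumes "trivial_group K"
  shows "squares_and_commutators_central K"
proof -
  interpret K: group K using assms by (simp add: trivial_group_def)
  have 1: "x = \<one>\<^bsub>K\<^esub>" if "x \<in> carrier K" for x using assms that by (auto simp: trivial_group_def)
  have "comm_group K"
  proof (rule K.group_comm_groupI)
    fix x y assume "x \<in> carrier K" "y \<in> carrier K"
    then show "x \<otimes>\<^bsub>K\<^esub> y = y \<otimes>\<^bsub>K\<^esub> x" using 1[of x] 1[of y] by metis
  qed
  then show ?thesis
    by (rule squares_and_commutators_central_comm) (intro 1 K.m_closed)
qed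

lemma squares_and_commutators_central_integer_mod_group:
  assumes "int n dvd 4"
  shows "squares_and_commutators_central (integer_mod_group n)"
proof (rule squares_and_commutators_central_comm[OF abelian_integer_mod_group])
  fix x :: int
  have "((x + x) mod int n + (x + x) mod int n) mod int n = ((x + x) + (x + x)) mod int n"
    by (rule mod_add_eq)
  also have "(x + x) + (x + x) = 4 * x" by simp
  also have "4 * x mod int n = 0" using assms by simp
  finally show "(x \<otimes>\<^bsub>integer_mod_group n\<^esub> x) \<otimes>\<^bsub>integer_mod_group n\<^esub> (x \<otimes>\<^bsub>integer_mod_group n\<^esub> x)
      = \<one>\<^bsub>integer_mod_group n\<^esub>" by simp
qed

lemma squares_and_commutators_central_D4: "squares_and_commutators_central D4"
proof -
  note c = carrier_D4
  have m: "(i, a) \<otimes>\<^bsub>D4\<^esub> (j, b) = ((if a = 0 then i + j else i - j) mod 4, (a + b) mod 2)" for i a j b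
    by (simp add: D4_def)
  have one: "\<one>\<^bsub>D4\<^esub> = (0, 0)" by (simp add: D4_def)
  have Z: "(0, 0) \<in> central_involutions D4" "(2, 0) \<in> central_involutions D4"
    unfolding central_involutions_def c one by (auto simp: m)
  have sq: "x \<otimes>\<^bsub>D4\<^esub> x \<in> {(0, 0), (2, 0)}" if "x \<in> carrier D4" for x
    using that unfolding c by (auto simp: m)
  have comm: "x \<otimes>\<^bsub>D4\<^esub> y = y \<otimes>\<^bsub>D4\<^esub> x \<otimes>\<^bsub>D4\<^esub> (0, 0) \<or> x \<otimes>\<^bsub>D4\<^esub> y = y \<otimes>\<^bsub>D4\<^esub> x \<otimes>\<^bsub>D4\<^esub> (2, 0)"
    if "x \<in> carrier D4" "y \<in> carrier D4" for x y
    using that unfolding c by (elim SigmaE insertE emptyE; simp add: m)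
  have "x \<otimes>\<^bsub>D4\<^esub> x \<in> central_involutions D4" if "x \<in> carrier D4" for x
    using sq[OF that] Z by (elim insertE emptyE) simp_all
  then show ?thesis unfolding squares_and_commutators_central_def using Z comm by metis
qed

context profinite_group
begin

lemma continuous_map_of_cosets:
  assumes N: "subgroup N G" "openin T N" and F: "\<And>x. x \<in> carrier G \<Longrightarrow> F (N #> x) \<in> A"
  shows "continuous_map T (discrete_topology A) (\<lambda>x. F (N #> x))"
  unfolding continuous_map_def
proof (intro conjI allI impI)
  show "(\<lambda>x. F (N #> x)) \<in> topspace T \<rightarrow> topspace (discrete_topology A)" using F by (simp add: topspace_eq)
  fix S assume "openin (discrete_topology A) S"
  let ?S = "{x \<in> topspace T. F (N #> x) \<in> S}"
  show "openin T ?S"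
  proof (rule open_union_of_cosets[OF N(2,1)])
    fix s assume s: "s \<in> ?S"
    then have sc: "s \<in> carrier G" by (simp add: topspace_eq)
    show "N #> s \<subseteq> ?S"
    proof
      fix y assume y: "y \<in> N #> s"
      then have "N #> y = N #> s" using repr_independence[OF y sc N(1)] by simp
      moreover have "y \<in> carrier G" using y r_coset_subset_G[OF subgroup.subset[OF N(1)] sc] by blast
      ultimately show "y \<in> ?S" using s by (simp add: topspace_eq)
    qed
  qed (simp add: topspace_eq)
qed

lemma D3_subset:
  assumes N: "N \<lhd> G" "openin T N" and K: "group K" "G Mod N \<cong> K" "squares_and_commutators_central K"
  shows "D 3 \<subseteq> N"
proof -
  interpret N: normal N G by (rule N(1))
  interpret K: group K by (rule K(1))
  interpret Q: group "G Mod N" by (rule N.factorgroup_is_group)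
  obtain \<phi> where \<phi>: "\<phi> \<in> iso (G Mod N) K" using K(2) by (auto simp: is_iso_def)
  interpret \<phi>: group_hom "G Mod N" K \<phi> using \<phi> by unfold_locales (simp add: iso_def)
  define \<rho> where "\<rho> = (\<lambda>x. \<phi> (N #> x))"
  have "\<rho> \<in> hom G K"
    using Group.hom_compose[OF N.r_coset_hom_Mod \<phi>.homh] by (simp add: \<rho>_def o_def)
  then interpret \<rho>: group_hom G K \<rho> by unfold_locales
  have cont: "continuous_map T (discrete_topology (carrier K)) \<rho>"
    using \<rho>.hom_closed unfolding \<rho>_def by (intro continuous_map_of_cosets N.subgroup_axioms N(2))
  have ker: "\<rho> x = \<one>\<^bsub>K\<^esub> \<longleftrightarrow> x \<in> N" if x: "x \<in> carrier G" for x
  proof -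
    have inj: "inj_on \<phi> (carrier (G Mod N))" using \<phi> by (auto simp: iso_def bij_betw_def)
    have "N #> x \<in> carrier (G Mod N)" using x by (auto simp: carrier_FactGroup)
    then have "\<rho> x = \<one>\<^bsub>K\<^esub> \<longleftrightarrow> N #> x = \<one>\<^bsub>G Mod N\<^esub>"
      using inj_onD[OF inj _ _ Q.one_closed] \<phi>.hom_one unfolding \<rho>_def by metis
    then show ?thesis using r_coset_eq_subgroup_iff[OF N.subgroup_axioms x] by simp
  qed
  define M where "M = {x \<in> carrier G. \<rho> x \<in> central_involutions K}"
  have sq: "\<rho> (x \<otimes> x) \<in> central_involutions K" if "x \<in> carrier G" for x
    using that K(3) \<rho>.hom_closed by (simp add: squares_and_commutators_central_def)
  have comm: "\<rho> (inv x \<otimes> inv y \<otimes> x \<otimes> y) \<in> central_involutions K" if xy: "x \<in> carrier G" "y \<in> carrier G" for x y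
  proof -
    obtain z where z: "z \<in> central_involutions K" "\<rho> x \<otimes>\<^bsub>K\<^esub> \<rho> y = \<rho> y \<otimes>\<^bsub>K\<^esub> \<rho> x \<otimes>\<^bsub>K\<^esub> z"
      using K(3) xy \<rho>.hom_closed unfolding squares_and_commutators_central_def by blast
    then have "z \<in> carrier K" by (simp add: central_involutionsD)
    moreover have "inv x \<otimes> inv y \<otimes> x \<otimes> y = inv x \<otimes> (inv y \<otimes> (x \<otimes> y))" using xy by (simp add: m_assoc)
    ultimately have "\<rho> (inv x \<otimes> inv y \<otimes> x \<otimes> y) = z"
      using xy z(2) by (simp add: K.m_assoc K.inv_mult_cancel_left)
    then show ?thesis using z by simp
  qed
  interpret CI: subgroup "central_involutions K" K by (rule K.subgroup_central_involutions)
  have "subgroup M G"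
  proof (rule subgroupI)
    have "\<one> \<in> M" by (simp add: M_def)
    then show "M \<noteq> {}" by blast
  qed (auto simp: M_def)
  moreover have "closedin T M"
    using closedin_continuous_map_preimage[OF cont, of "central_involutions K"]
    using CI.subset by (simp add: M_def topspace_eq)
  ultimately have "D (Suc (Suc 0)) \<subseteq> M"
    unfolding D_Suc D_1 using sq comm by (intro closed_subgroup_generated_minimal) (auto simp: M_def)
  then have D2M: "h \<in> M" if "h \<in> D (Suc (Suc 0))" for h using that by blast
  have "N = {x \<in> topspace T. \<rho> x \<in> {\<one>\<^bsub>K\<^esub>}}" using ker N.subset by (auto simp: topspace_eq)
  then have "closedin T N"
    using closedin_continuous_map_preimage[OF cont, of "{\<one>\<^bsub>K\<^esub>}"] by simp
  moreover have "h \<otimes> h \<in> N" if "h \<in> M" for h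
    using that ker[of "h \<otimes> h"] central_involutionsD(2)[of "\<rho> h" K] by (simp add: M_def)
  moreover have "inv h \<otimes> inv x \<otimes> h \<otimes> x \<in> N" if h: "h \<in> M" and x: "x \<in> carrier G" for h x
  proof -
    have hc: "h \<in> carrier G" and "\<rho> h \<otimes>\<^bsub>K\<^esub> \<rho> x = \<rho> x \<otimes>\<^bsub>K\<^esub> \<rho> h"
      using h central_involutionsD(3)[of "\<rho> h" K "\<rho> x"] \<rho>.hom_closed[OF x] unfolding M_def by blast+
    then have "\<rho> (inv h \<otimes> (inv x \<otimes> (h \<otimes> x))) = \<one>\<^bsub>K\<^esub>"
      using x by (simp add: K.inv_mult_cancel_left)
    then show ?thesis using ker[of "inv h \<otimes> (inv x \<otimes> (h \<otimes> x))"] hc x by (simp add: m_assoc)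
  qed
  ultimately have "D (Suc (Suc (Suc 0))) \<subseteq> N"
    unfolding D_Suc[of "Suc 0"] using D2M by (intro closed_subgroup_generated_minimal N.subgroup_axioms) auto
  then show ?thesis by (simp add: numeral_3_eq_3)
qed

text \<open>
  A maximal open normal subgroup that contains \<open>D 2\<close> and avoids \<open>g\<close> would have index 2.
\<close>

lemma in_D2:
  assumes g: "g \<in> carrier G"
    and N: "\<And>N. N \<lhd> G \<Longrightarrow> openin T N \<Longrightarrow> G Mod N \<cong> Z2 \<Longrightarrow> g \<in> N"
  shows "g \<in> D 2"
proof (rule ccontr)
  assume "g \<notin> D 2"
  then have g2: "g \<notin> D (Suc (Suc 0))" by (simp add: numeral_2_eq_2)
  obtain U where U: "U \<lhd> G" "openin T U" "g \<notin> U" "carrier G \<subseteq> U \<union> (U #> g)"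
  proof (rule maximal_open_normal_subgroup_avoiding[OF normal_D closedin_D subset_refl g g2])
    show "h \<otimes> h \<in> D (Suc (Suc 0))" if "h \<in> carrier G" for h
      using square_in_D_Suc[of h 0] that by (simp add: D_1)
    show "inv h \<otimes> inv x \<otimes> h \<otimes> x \<in> D (Suc (Suc 0))" if "h \<in> carrier G" "x \<in> carrier G" for h x
      using commutator_in_D_Suc[of h 0 x] that by (simp add: D_1)
  qed
  interpret U: normal U G by (rule U(1))
  note sub = U.subgroup_axioms
  let ?\<rho> = "\<lambda>x. if x \<in> U then 0 else 1 :: int"
  have coset: "U #> x = U #> g" if "x \<in> carrier G - U" for x
    using U(4) that r_coset_eq_iff[OF sub _ g, of x] by blast
  have "x \<otimes> y \<in> U" if x: "x \<in> carrier G - U" and y: "y \<in> carrier G - U" for x y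
  proof -
    have "inv x \<in> carrier G - U" using x U.m_inv_closed[of "inv x"] by auto
    then have "U #> y = U #> inv x" using coset y by metis
    then have "y \<in> U #> inv x" using r_coset_eq_iff[OF sub, of y "inv x"] x y by simp
    then obtain u where "u \<in> U" "y = u \<otimes> inv x" by (auto simp: r_coset_def)
    then have "x \<otimes> y = x \<otimes> u \<otimes> inv x" using x U.mem_carrier by (simp add: m_assoc)
    then show ?thesis using U.inv_op_closed2 x \<open>u \<in> U\<close> by simp
  qed
  then have hom: "?\<rho> \<in> hom G Z2" by (rule index_two_indicator_hom[OF sub])
  have rng: "?\<rho> ` carrier G = carrier Z2"
    using U(3) g U.one_closed unfolding carrier_Z2 by (auto simp: image_iff intro: bexI[of _ g] bexI[of _ \<one>])
  have "continuous_map T (discrete_topology (carrier Z2)) (\<lambda>x. (\<lambda>K. if K = U then 0 else 1) (U #> x))"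
    using U(2) sub by (intro continuous_map_of_cosets) (auto simp: carrier_Z2)
  then have cont: "continuous_map T (discrete_topology (carrier Z2)) ?\<rho>"
    by (rule continuous_map_eq) (simp add: topspace_eq r_coset_eq_subgroup_iff[OF sub])
  have "g \<in> kernel G Z2 ?\<rho>"
    using N open_kernel_quotient[OF _ hom rng cont] by simp
  then show False using U(3) by (simp add: kernel_def)
qed

text \<open>
  The quadratic function of the finite quotient \<open>Q\<close> is pulled back to \<open>G\<close>; its list of pairs of characters
  becomes the formal sum \<open>c\<close>.
\<close>

lemma quadratic_cochain_separating:
  assumes g: "g \<in> D 2" "g \<notin> D 3"
  obtains f c where "f \<in> carrier C1" "c \<in> carrier FF" "\<delta>1 f = cup_cocycle c" "f g = 1"
proof -
  have g2: "g \<in> D (Suc (Suc 0))" "g \<notin> D (Suc (Suc (Suc 0)))"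
    using g by (simp_all add: numeral_2_eq_2 numeral_3_eq_3)
  interpret D2: normal "D (Suc (Suc 0))" G by (rule normal_D)
  obtain U where U: "U \<lhd> G" "openin T U" "g \<notin> U" "D (Suc (Suc 0)) \<subseteq> U \<union> (U #> g)"
    using maximal_open_normal_subgroup_avoiding[OF normal_D closedin_D D2.subset g2]
      square_in_D_Suc commutator_in_D_Suc by metis
  interpret U: normal U G by (rule U(1))
  interpret Q: group "G Mod U" by (rule U.factorgroup_is_group)
  interpret \<pi>: group_hom G "G Mod U" "\<lambda>x. U #> x" by unfold_locales (rule U.r_coset_hom_Mod)
  note sub = U.subgroup_axioms
  have gc: "g \<in> carrier G" using g2 D2.subset by blast
  have two: "U #> d \<in> {\<one>\<^bsub>G Mod U\<^esub>, U #> g}" if "d \<in> D (Suc (Suc 0))" for d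
    using U(4) that r_coset_eq_iff[OF sub _ gc, of d] r_coset_eq_subgroup_iff[OF sub, of d] D2.mem_carrier by auto
  have lift: "\<exists>x\<in>carrier G. K = U #> x" if "K \<in> carrier (G Mod U)" for K
    using that by (auto simp: carrier_FactGroup)
  interpret Q: squares_and_commutators_in_pair "G Mod U" "U #> g"
  proof
    show "U #> g \<in> carrier (G Mod U)" using gc by (rule \<pi>.hom_closed)
    show "U #> g \<noteq> \<one>\<^bsub>G Mod U\<^esub>" using U(3) r_coset_eq_subgroup_iff[OF sub gc] by simp
    fix K assume "K \<in> carrier (G Mod U)"
    then obtain x where x: "x \<in> carrier G" "K = U #> x" using lift by blast
    have "x \<otimes> x \<in> D (Suc (Suc 0))" using square_in_D_Suc[of x 0] x by (simp add: D_1)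
    then show "K \<otimes>\<^bsub>G Mod U\<^esub> K \<in> {\<one>\<^bsub>G Mod U\<^esub>, U #> g}"
      using two \<pi>.hom_mult[OF x(1) x(1)] x by metis
    fix L assume "L \<in> carrier (G Mod U)"
    then obtain y where y: "y \<in> carrier G" "L = U #> y" using lift by blast
    have "inv x \<otimes> inv y \<otimes> x \<otimes> y \<in> D (Suc (Suc 0))" using commutator_in_D_Suc[of x 0 y] x y by (simp add: D_1)
    moreover have "inv\<^bsub>G Mod U\<^esub> K \<otimes>\<^bsub>G Mod U\<^esub> inv\<^bsub>G Mod U\<^esub> L \<otimes>\<^bsub>G Mod U\<^esub> K \<otimes>\<^bsub>G Mod U\<^esub> L = U #> (inv x \<otimes> inv y \<otimes> x \<otimes> y)"
      unfolding x(2) y(2) using x(1) y(1)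
      by (simp only: \<pi>.hom_mult \<pi>.hom_inv m_closed inv_closed)
    ultimately show "inv\<^bsub>G Mod U\<^esub> K \<otimes>\<^bsub>G Mod U\<^esub> inv\<^bsub>G Mod U\<^esub> L \<otimes>\<^bsub>G Mod U\<^esub> K \<otimes>\<^bsub>G Mod U\<^esub> L \<in> {\<one>\<^bsub>G Mod U\<^esub>, U #> g}"
      using two by metis
  qed
  have "finite (carrier (G Mod U))" using finite_rcosets_open[OF U(2) sub] by (simp add: FactGroup_def)
  then obtain f ps where q: "Q.quadratic_on (carrier (G Mod U)) f ps" by (rule Q.quadratic_on_carrier)
  define pull where "pull = (\<lambda>\<psi>. \<lambda>x\<in>carrier G. \<psi> (U #> x) mod 2 :: int)"
  have pull_C1: "pull \<psi> \<in> carrier C1" for \<psi>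
  proof -
    have "continuous_map T (discrete_topology (carrier Z2)) (\<lambda>x. (\<lambda>K. \<psi> K mod 2) (U #> x))"
      by (rule continuous_map_of_cosets[OF sub U(2)]) simp
    from continuous_functions_restrictI[OF this] show ?thesis by (simp add: pull_def topspace_eq)
  qed
  have pull_H1: "pull \<psi> \<in> carrier HH1" "x \<in> carrier G \<Longrightarrow> pull \<psi> x = \<psi> (U #> x)"
    if \<psi>: "\<psi> \<in> hom (G Mod U) Z2" for \<psi> x
  proof -
    have val: "pull \<psi> x = \<psi> (U #> x)" if x: "x \<in> carrier G" for x
    proof -
      have "\<psi> (U #> x) \<in> {0, 1}" using \<psi> \<pi>.hom_closed[OF x] unfolding hom_Z2_iff by blast
      then show ?thesis using x by (auto simp: pull_def)
    qed
    then show "x \<in> carrier G \<Longrightarrow> pull \<psi> x = \<psi> (U #> x)" by blast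
    have "pull \<psi> (x \<otimes> y) = (pull \<psi> x + pull \<psi> y) mod 2" if xy: "x \<in> carrier G" "y \<in> carrier G" for x y
      unfolding val[OF xy(1)] val[OF xy(2)] val[OF m_closed[OF xy]] \<pi>.hom_mult[OF xy]
      using \<psi> \<pi>.hom_closed xy unfolding hom_Z2_iff by blast
    then show "pull \<psi> \<in> carrier HH1" using pull_C1 unfolding carrier_H1 by blast
  qed
  define c where "c = (\<Sum>(\<psi>, \<psi>') \<leftarrow> ps. frag_of (pull \<psi>, pull \<psi>'))"
  have "\<forall>p\<in>set ps. fst p \<in> hom (G Mod U) Z2 \<and> snd p \<in> hom (G Mod U) Z2"
    using q unfolding Q.quadratic_on_def by auto
  then have c: "Poly_Mapping.keys c \<subseteq> carrier HH1 \<times> carrier HH1 \<and>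
      (\<forall>x\<in>carrier G. \<forall>y\<in>carrier G. cup_form c x y = sum_of_products ps (U #> x) (U #> y))"
    unfolding c_def
  proof (induction ps)
    case Nil
    then show ?case by (simp add: sum_of_products_def)
  next
    case (Cons p ps)
    obtain \<psi> \<psi>' where p: "p = (\<psi>, \<psi>')" by force
    let ?c = "\<Sum>(\<psi>, \<psi>') \<leftarrow> ps. frag_of (pull \<psi>, pull \<psi>')"
    have "Poly_Mapping.keys (frag_of (pull \<psi>, pull \<psi>') + ?c) \<subseteq> carrier HH1 \<times> carrier HH1"
      using keys_add[of "frag_of (pull \<psi>, pull \<psi>')" ?c] Cons p pull_H1(1) by (auto simp: keys_frag_of)
    then show ?case using Cons p pull_H1(2) by (simp add: cup_form_add sum_of_products_def)
  qed
  have "\<delta>1 (pull f) = cup_cocycle c"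
  proof (rule extensionalityI[OF coboundary1_extensional])
    show "cup_cocycle c \<in> extensional (carrier G \<times> carrier G)" by (simp add: cup_cocycle_def)
    fix p assume "p \<in> carrier G \<times> carrier G"
    then obtain x y where xy: "p = (x, y)" "x \<in> carrier G" "y \<in> carrier G" by blast
    have e: "even (f (U #> (x \<otimes> y)) + f (U #> x) + f (U #> y) + sum_of_products ps (U #> x) (U #> y))"
      using q \<pi>.hom_closed xy unfolding Q.quadratic_on_def \<pi>.hom_mult[OF xy(2,3)] by blast
    have pull_f: "pull f v = f (U #> v) mod 2" if "v \<in> carrier G" for v
      using that by (simp add: pull_def)
    have "even ((f (U #> x) mod 2 + f (U #> y) mod 2 + f (U #> (x \<otimes> y)) mod 2) - cup_form c x y)"
      using e c xy by (simp del: \<pi>.hom_mult, argo)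
    then show "\<delta>1 (pull f) p = cup_cocycle c p"
      unfolding xy(1) coboundary1_apply[OF pull_C1 xy(2,3)] cup_cocycle_apply[OF xy(2,3)]
        pull_f[OF xy(2)] pull_f[OF xy(3)] pull_f[OF m_closed[OF xy(2,3)]] by (simp only: mod_eq_dvd_iff)
  qed
  moreover have "pull f g = 1" using q gc by (simp add: pull_def Q.quadratic_on_def)
  moreover have "c \<in> carrier FF" using c by simp
  ultimately show thesis using that[OF pull_C1] by blast
qed

text \<open>
  Two cochains with the same coboundary differ by a character, and characters are trivial on \<open>D 2\<close>. One of the
  two is 1 at \<open>g\<close> by the choice of the quotient, the other is 0 at \<open>g\<close> by the assumption on the kernels.
\<close>

lemma in_D3:
  assumes rel: "galois_relation_type G T" and g: "g \<in> carrier G"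
    and N: "\<And>N. N \<lhd> G \<Longrightarrow> openin T N \<Longrightarrow>
      G Mod N \<cong> Z2 \<or> G Mod N \<cong> integer_mod_group 4 \<or> G Mod N \<cong> D4 \<Longrightarrow> g \<in> N"
  shows "g \<in> D 3"
proof (rule ccontr)
  assume g3: "g \<notin> D 3"
  have g2: "g \<in> D 2" using in_D2[OF g] N by blast
  obtain f c where f: "f \<in> carrier C1" "c \<in> carrier FF" "\<delta>1 f = cup_cocycle c" "f g = 1"
    using quadratic_cochain_separating[OF g2 g3] .
  obtain S where S: "S \<subseteq> {pure_tensor HH1 HH1 \<psi> \<psi>' | \<psi> \<psi>'. \<psi> \<in> carrier HH1 \<and> \<psi>' \<in> carrier HH1}"
    "kernel (tensor_product HH1 HH1) HH2 (tensor_lift HH2 (cup G T)) = generate (tensor_product HH1 HH1) S"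
    using rel unfolding galois_relation_type_def Let_def by blast
  have pure: "f g = 0" if \<psi>: "\<psi> \<in> carrier HH1" "\<psi>' \<in> carrier HH1" and f: "f \<in> carrier C1"
    and df: "\<delta>1 f = cup_cocycle (frag_of (\<psi>, \<psi>'))" for \<psi> \<psi>' f
  proof (rule vanishing_on_intersection_of_kernels[OF \<psi> f _ g])
    fix x y assume xy: "x \<in> carrier G" "y \<in> carrier G"
    have "(f x + f y + f (x \<otimes> y)) mod 2 = (\<psi> x * \<psi>' y) mod 2"
      using df coboundary1_apply[OF f xy] cup_cocycle_apply[OF xy] by simp
    then show "even (f (x \<otimes> y) + f x + f y + \<psi> x * \<psi>' y)"
      by (simp add: mod_eq_dvd_iff ac_simps del: even_add even_diff) (simp, argo)
  qed (use character_trivial_on_D2 g2 N in blast)+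
  obtain f' where f': "f' \<in> carrier C1" "\<delta>1 f' = cup_cocycle c" "f' g = 0"
  proof (rule cochain_vanishing_of_pure_tensors[OF S g _ f(2,1,3)])
    fix \<psi> \<psi>' f assume "\<psi> \<in> carrier HH1" "\<psi>' \<in> carrier HH1" "f \<in> carrier C1" "\<delta>1 f = cup_cocycle (frag_of (\<psi>, \<psi>'))"
    then show "f g = 0" by (rule pure)
  qed
  interpret C1: comm_group C1 by (rule comm_group_C)
  interpret d: group_hom C1 C2 \<delta>1 by (rule group_hom_coboundary1)
  have "\<delta>1 (f \<otimes>\<^bsub>C1\<^esub> f') = cup_cocycle c \<otimes>\<^bsub>C2\<^esub> cup_cocycle c"
    unfolding d.hom_mult[OF f(1) f'(1)] f(3) f'(2) by (rule refl)
  also have "\<dots> = cup_cocycle c \<otimes>\<^bsub>ZZ2\<^esub> cup_cocycle c" by (simp add: cocycles2_def)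
  also have "\<dots> = \<one>\<^bsub>ZZ2\<^esub>" using cup_cocycle_diff[of c c] one_cocycles2 by simp
  finally have "\<delta>1 (f \<otimes>\<^bsub>C1\<^esub> f') = \<one>\<^bsub>C2\<^esub>" by (simp add: cocycles2_def)
  then have "f \<otimes>\<^bsub>C1\<^esub> f' \<in> carrier HH1"
    using C1.m_closed[OF f(1) f'(1)] by (simp add: H1_def kernel_def)
  then have "(f \<otimes>\<^bsub>C1\<^esub> f') g = 0" using g2 by (rule character_trivial_on_D2)
  then show False using f(4) f'(3) g by (simp add: topspace_eq)
qed

end

theorem corollary11p3:
  fixes G :: "('a, 'b) monoid_scheme" and T :: "'a topology"
  assumes "profinite_group G T" and "galois_relation_type G T"
  shows "descending_central G T 3 =
    \<Inter> {N. N \<lhd> G \<and> openin T N \<and>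
          (trivial_group (G Mod N) \<or> G Mod N \<cong> integer_mod_group 2 \<or>
           G Mod N \<cong> integer_mod_group 4 \<or> G Mod N \<cong> D4)}" (is "_ = \<Inter> ?\<N>")
proof -
  interpret profinite_group G T by (rule assms(1))
  show ?thesis
  proof (intro equalityI subsetI InterI)
    fix g N assume g: "g \<in> descending_central G T 3" and "N \<in> ?\<N>"
    then have N: "N \<lhd> G" "openin T N" and
      K: "trivial_group (G Mod N) \<or> G Mod N \<cong> Z2 \<or> G Mod N \<cong> integer_mod_group 4 \<or> G Mod N \<cong> D4" by auto
    interpret N: normal N G by (rule N)
    have quot: "group (G Mod N)" by (rule N.factorgroup_is_group)
    have "squares_and_commutators_central (G Mod N)" if "trivial_group (G Mod N)"
      by (rule squares_and_commutators_central_trivial[OF that])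
    moreover have "squares_and_commutators_central Z2" "squares_and_commutators_central (integer_mod_group 4)"
      by (simp_all add: squares_and_commutators_central_integer_mod_group)
    ultimately have "D 3 \<subseteq> N"
      using K D3_subset[OF N quot iso_refl] D3_subset[OF N group_integer_mod_group]
        D3_subset[OF N group_D4 _ squares_and_commutators_central_D4] by (elim disjE) simp_all
    then show "g \<in> N" using g by blast
  next
    fix g assume g: "g \<in> \<Inter> ?\<N>"
    have "carrier G \<in> ?\<N>"
    proof -
      have nor: "carrier G \<lhd> G" using normal_invI[OF subgroup_self] by simp
      moreover have "carrier (G Mod carrier G) = {\<one>\<^bsub>G Mod carrier G\<^esub>}"
        using coset_join2[OF _ subgroup_self] by (auto simp: carrier_FactGroup)
      then have "trivial_group (G Mod carrier G)"
        using normal.factorgroup_is_group[OF nor] by (simp add: trivial_group_def)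
      moreover have "openin T (carrier G)" using openin_topspace[of T] by (simp add: topspace_eq)
      ultimately show ?thesis by blast
    qed
    then have "g \<in> carrier G" using g by blast
    then show "g \<in> descending_central G T 3" using in_D3[OF assms(2)] g by blast
  qed
qed

end
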